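(* Let $(M,d,0)$ be a nontrivial pointed metric space (i.e. with at least two points), let $G$ be a group with identity $e$ acting on $M$ by similarities fixing $0$, and let $\chi\colon G\to(0,\infty)$ be the associated similarity character, so that $d(gx,gy)=\chi(g)d(x,y)$ for all $g\in G$, $x,y\in M$. Put $$\mathcal Y_{G,\chi}=\overline{\operatorname{span}}\{\delta_{gx}-\chi(g)\delta_x: g\in G,\ x\in M\}\subseteq\mathcal F(M)$$ (norm closure), let $\mathcal F^{G,\chi}(M)=\mathcal F(M)/\mathcal Y_{G,\chi}$, and let $q_{G,\chi}\colon\mathcal F(M)\to\mathcal F^{G,\chi}(M)$ be the quotient map. Then the following hold. (i) For each $g\in G$, the formula $(U_gf)(x)=\chi(g)f(g^{-1}x)$, for $f\in\operatorname{Lip}_0(M)$ and $x\in M$, defines a surjective linear isometry $U_g\colon\operatorname{Lip}_0(M)\to\operatorname{Lip}_0(M)$. There also exists a unique surjective linear isometry $V_g\colon\mathcal F(M)\to\mathcal F(M)$ satisfying $V_g\delta_x=\chi(g)^{-1}\delta_{gx}$ for every $x\in M$. These operators satisfy $U_e=I_{\operatorname{Lip}_0(M)}$, $V_e=I_{\mathcal F(M)}$, $U_gU_h=U_{gh}$ and $V_gV_h=V_{gh}$ for all $g,h\in G$. Under the canonical identification $\mathcal F(M)^*=\operatorname{Lip}_0(M)$, for every $g\in G$ one has $U_g=V_{g^{-1}}^*$, and $$\operatorname{Fix}(U):=\{f\in\operatorname{Lip}_0(M): U_gf=f\text{ for every }g\in G\}=\operatorname{Lip}_0^{G,\chi}(M).$$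 (ii) One has $$\mathcal Y_{G,\chi}=\overline{\operatorname{span}}\{V_g\mu-\mu: g\in G,\ \mu\in\mathcal F(M)\}$$ (closure in the norm of $\mathcal F(M)$), and its annihilator is $$\mathcal Y_{G,\chi}^{\perp}:=\{f\in\operatorname{Lip}_0(M):\langle\mu,f\rangle=0\text{ for every }\mu\in\mathcal Y_{G,\chi}\}=\operatorname{Lip}_0^{G,\chi}(M).$$ In particular, the adjoint $q_{G,\chi}^*\colon(\mathcal F^{G,\chi}(M))^*\to\operatorname{Lip}_0(M)$ is a linear isometry with range $\operatorname{Lip}_0^{G,\chi}(M)$, given explicitly by $(q_{G,\chi}^*\varphi)(x)=\varphi(q_{G,\chi}(\delta_x))$ for $\varphi\in(\mathcal F^{G,\chi}(M))^*$, $x\in M$. (iii) For every real Banach space $E$ and every $f\in\operatorname{Lip}_0^{G,\chi}(M,E)$, there exists a unique bounded linear operator $\widetilde f\colon\mathcal F^{G,\chi}(M)\to E$ such that $\widetilde f(q_{G,\chi}(\delta_x))=f(x)$ for every $x\in M$. If $\widehat f\colon\mathcal F(M)\to E$ denotes the canonical linearization of $f$, then $\widehat f=\widetilde f\circ q_{G,\chi}$ and $\|\widetilde f\|=\|\widehat f\|=\operatorname{Lip}(f)$. Moreover, the map $$\Lambda_E\colon\operatorname{Lip}_0^{G,\chi}(M,E)\to\mathcal L(\mathcal F^{G,\chi}(M),E),\qquad \Lambda_E(f)=\widetilde f,$$ is a surjective linear isometry, with inverse $\Lambda_E^{-1}(T)=T\circ q_{G,\chi}\circ\delta_M$ for $T\in\mathcal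 L(\mathcal F^{G,\chi}(M),E)$.
   Context: All Banach spaces are real. For a pointed metric space $(M,d,0)$ and a Banach space $E$, $\operatorname{Lip}_0(M,E)$ is the Banach space of Lipschitz maps $f\colon M\to E$ with $f(0)=0$, with norm $\operatorname{Lip}(f)=\sup_{x\ne y}\|f(x)-f(y)\|/d(x,y)$; $\operatorname{Lip}_0(M)=\operatorname{Lip}_0(M,\mathbb R)$. For $x\in M$, $\delta_x=\delta_M(x)\in\operatorname{Lip}_0(M)^*$ is evaluation at $x$, and the Lipschitz-free space is $\mathcal F(M)=\overline{\operatorname{span}}\{\delta_x:x\in M\}\subseteq\operatorname{Lip}_0(M)^*$ (norm closure). The map $\delta_M\colon M\to\mathcal F(M)$ is an isometric embedding with $\delta_0=0$; every $f\in\operatorname{Lip}_0(M,E)$ has a unique bounded linear extension (its linearization) $\widehat f\colon\mathcal F(M)\to E$ with $\widehat f(\delta_x)=f(x)$, and $\|\widehat f\|=\operatorname{Lip}(f)$. In particular $\mathcal F(M)^*=\operatorname{Lip}_0(M)$ canonically, with $\langle\delta_x,f\rangle=f(x)$. A group $G$ acts on $M$ by similarities if each $x\mapsto gx$ is a bijection of $M$ multiplying all distances by a fixed positive constant; this constant is $\chi(g)$, and $\chi\colon G\to(0,\infty)$ is a group homomorphism called the similarity character of the action. The space of $\chi$-equivariant maps is $\operatorname{Lip}_0^{G,\chi}(M,E)=\{f\in\operatorname{Lip}_0(M,E): f(gx)=\chi(g)f(x)\text{ for all }g\in G,\ x\in M\}$, and $\operatorname{Lip}_0^{G,\chi}(M)=\operatorname{Lip}_0^{G,\chi}(M,\mathbb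 R)$. $\mathcal L(X,Y)$ is the Banach space of bounded linear operators with the operator norm. *)

theory Defs
  imports "HOL-Analysis.Analysis" "HOL-Algebra.Group_Action"
begin

section \<open>Spaces of Lipschitz maps vanishing at the base point\<close>

text \<open>The base point of a pointed metric space is written \<^term>\<open>0\<close>; no algebraic structure is
  attached to it.\<close>

class pointed_metric_space = metric_space + zero

typedef (overloaded) ('m, 'e) lip0 =
  "{f :: 'm::pointed_metric_space \<Rightarrow> 'e::real_normed_vector.
      f 0 = 0 \<and> (\<exists>C. C-lipschitz_on UNIV f)}"
  morphisms lip0_apply Lip0
  by (rule exI[of _ "\<lambda>_. 0"]) (auto intro!: exI[of _ 0] lipschitz_onI)

setup_lifting type_definition_lip0

lemma lip0_eqI: "(\<And>x. lip0_apply f x = lip0_apply g x) \<Longrightarrow> f = g"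
  by transfer auto

lemma lip0_apply_base [simp]: "lip0_apply f 0 = 0"
  by transfer auto

text \<open>The pairs \<open>(x, x)\<close> contribute the quotient \<open>0 / 0 = 0\<close>, so they do
  not affect the supremum, which is then over a nonempty set also for a one-point space.\<close>

definition lip_const :: "('m::metric_space \<Rightarrow> 'e::real_normed_vector) \<Rightarrow> real" where
  "lip_const f = (SUP (x, y). norm (f x - f y) / dist x y)"

lemma lip_const_bdd:
  fixes f :: "'m::metric_space \<Rightarrow> 'e::real_normed_vector"
  assumes "C-lipschitz_on UNIV f"
  shows "bdd_above (range (\<lambda>(x, y). norm (f x - f y) / dist x y))"
proof (rule bdd_aboveI2)
  fix p :: "'m \<times> 'm"
  show "(\<lambda>(x, y). norm (f x - f y) / dist x y) p \<le> C"
  proof (cases p)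
    case (Pair x y)
    show ?thesis
      using lipschitz_onD[OF assms, of x y] lipschitz_on_nonneg[OF assms] Pair
      by (cases "x = y") (auto simp: divide_simps dist_norm)
  qed
qed

lemma lip_const_ge:
  fixes f :: "'m::metric_space \<Rightarrow> 'e::real_normed_vector"
  assumes "C-lipschitz_on UNIV f"
  shows "norm (f x - f y) \<le> lip_const f * dist x y"
proof -
  have "norm (f x - f y) / dist x y \<le> lip_const f"
    unfolding lip_const_def
    using cSUP_upper[OF UNIV_I lip_const_bdd[OF assms], of "(x, y)"] by simp
  then show ?thesis
    by (cases "x = y") (auto simp: divide_simps split: if_splits)
qed

lemma lip_const_le:
  fixes f :: "'m::metric_space \<Rightarrow> 'e::real_normed_vector"
  assumes "\<And>x y. norm (f x - f y) \<le> C * dist x y" "0 \<le> C"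
  shows "lip_const f \<le> C"
  unfolding lip_const_def
proof (rule cSUP_least)
  fix p :: "'m \<times> 'm"
  show "(\<lambda>(x, y). norm (f x - f y) / dist x y) p \<le> C"
  proof (cases p)
    case (Pair x y)
    show ?thesis
      using assms(1)[of x y] assms(2) Pair
      by (cases "x = y") (auto simp: divide_simps)
  qed
qed simp

lemma lip_const_nonneg:
  fixes f :: "'m::metric_space \<Rightarrow> 'e::real_normed_vector"
  assumes "C-lipschitz_on UNIV f"
  shows "0 \<le> lip_const f"
  unfolding lip_const_def
  using cSUP_upper[OF UNIV_I lip_const_bdd[OF assms], of "(undefined, undefined)"] by simp

lemma lipschitz_add:
  fixes f g :: "'m::metric_space \<Rightarrow> 'e::real_normed_vector"
  assumes "C-lipschitz_on UNIV f" "D-lipschitz_on UNIV g"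
  shows "(C + D)-lipschitz_on UNIV (\<lambda>x. f x + g x)"
proof (rule lipschitz_onI)
  fix x y
  have "norm (f x + g x - (f y + g y)) \<le> norm (f x - f y) + norm (g x - g y)"
    using norm_triangle_ineq[of "f x - f y" "g x - g y"] by (simp add: algebra_simps)
  also have "\<dots> \<le> C * dist x y + D * dist x y"
    using lipschitz_onD[OF assms(1), of x y] lipschitz_onD[OF assms(2), of x y]
    by (simp add: dist_norm)
  finally show "dist (f x + g x) (f y + g y) \<le> (C + D) * dist x y"
    by (simp add: dist_norm algebra_simps)
qed (use lipschitz_on_nonneg assms in \<open>fastforce intro: add_nonneg_nonneg\<close>)

lemma lipschitz_scaleR:
  fixes f :: "'m::metric_space \<Rightarrow> 'e::real_normed_vector"
  assumes "C-lipschitz_on UNIV f"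
  shows "(\<bar>r\<bar> * C)-lipschitz_on UNIV (\<lambda>x. r *\<^sub>R f x)"
proof (rule lipschitz_onI)
  fix x y
  show "dist (r *\<^sub>R f x) (r *\<^sub>R f y) \<le> \<bar>r\<bar> * C * dist x y"
    using mult_left_mono[OF lipschitz_onD[OF assms, of x y], of "\<bar>r\<bar>"]
    by (simp add: dist_norm scaleR_diff_right[symmetric] mult.assoc)
qed (use lipschitz_on_nonneg[OF assms] in simp)

instantiation lip0 :: (pointed_metric_space, real_normed_vector) real_normed_vector
begin

lift_definition zero_lip0 :: "('a, 'b) lip0" is "\<lambda>_. 0"
  by (auto intro!: exI[of _ 0] lipschitz_onI)

lift_definition plus_lip0 :: "('a, 'b) lip0 \<Rightarrow> ('a, 'b) lip0 \<Rightarrow> ('a, 'b) lip0"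
  is "\<lambda>f g x. f x + g x"
  by (auto intro: lipschitz_add)

lift_definition scaleR_lip0 :: "real \<Rightarrow> ('a, 'b) lip0 \<Rightarrow> ('a, 'b) lip0"
  is "\<lambda>r f x. r *\<^sub>R f x"
  by (auto intro: lipschitz_scaleR)

lift_definition uminus_lip0 :: "('a, 'b) lip0 \<Rightarrow> ('a, 'b) lip0" is "\<lambda>f x. - f x"
  using lipschitz_scaleR[where r = "-1"] by fastforce

lift_definition minus_lip0 :: "('a, 'b) lip0 \<Rightarrow> ('a, 'b) lip0 \<Rightarrow> ('a, 'b) lip0"
  is "\<lambda>f g x. f x - g x"
  using lipschitz_add lipschitz_scaleR[where r = "-1"] by fastforce

lift_definition norm_lip0 :: "('a, 'b) lip0 \<Rightarrow> real" is lip_const .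

definition dist_lip0 :: "('a, 'b) lip0 \<Rightarrow> ('a, 'b) lip0 \<Rightarrow> real"
  where "dist_lip0 f g = norm (f - g)"

definition [code del]:
  "(uniformity :: (('a, 'b) lip0 \<times> ('a, 'b) lip0) filter) =
     (INF e\<in>{0 <..}. principal {(x, y). dist x y < e})"

definition open_lip0 :: "('a, 'b) lip0 set \<Rightarrow> bool"
  where [code del]:
    "open_lip0 S = (\<forall>x\<in>S. \<forall>\<^sub>F (x', y) in uniformity. x' = x \<longrightarrow> y \<in> S)"

definition sgn_lip0 :: "('a, 'b) lip0 \<Rightarrow> ('a, 'b) lip0"
  where "sgn_lip0 f = scaleR (inverse (norm f)) f"

instance
proof
  fix f g h :: "('a, 'b) lip0" and r s :: real
  show "f + g + h = f + (g + h)" by transfer (simp add: add.assoc)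
  show "f + g = g + f" by transfer (simp add: add.commute)
  show "0 + f = f" by transfer simp
  show "- f + f = 0" by transfer simp
  show "f - g = f + - g" by transfer simp
  show "r *\<^sub>R (f + g) = r *\<^sub>R f + r *\<^sub>R g" by transfer (simp add: scaleR_add_right)
  show "(r + s) *\<^sub>R f = r *\<^sub>R f + s *\<^sub>R f" by transfer (simp add: scaleR_add_left)
  show "r *\<^sub>R s *\<^sub>R f = (r * s) *\<^sub>R f" by transfer simp
  show "1 *\<^sub>R f = f" by transfer simp
  show "dist f g = norm (f - g)" by (rule dist_lip0_def)
  show "sgn f = inverse (norm f) *\<^sub>R f" by (rule sgn_lip0_def)
  show "(uniformity :: (('a, 'b) lip0 \<times> ('a, 'b) lip0) filter) =
     (INF e\<in>{0 <..}. principal {(x, y). dist x y < e})" by (rule uniformity_lip0_def)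
  show "open U \<longleftrightarrow> (\<forall>x\<in>U. \<forall>\<^sub>F (x', y) in uniformity. x' = x \<longrightarrow> y \<in> U)"
    for U :: "('a, 'b) lip0 set" by (rule open_lip0_def)
  show "norm f = 0 \<longleftrightarrow> f = 0"
  proof
    assume "norm f = 0"
    then show "f = 0"
    proof transfer
      fix f :: "'a \<Rightarrow> 'b"
      assume f: "f 0 = 0 \<and> (\<exists>C. C-lipschitz_on UNIV f)" and 0: "lip_const f = 0"
      then obtain C where "C-lipschitz_on UNIV f" by blast
      from lip_const_ge[OF this, of _ 0] f 0 show "f = (\<lambda>_. 0)" by auto
    qed
  qed (transfer, simp add: lip_const_def case_prod_unfold)
  show "norm (f + g) \<le> norm f + norm g"
  proof transfer
    fix f g :: "'a \<Rightarrow> 'b"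
    assume "f 0 = 0 \<and> (\<exists>C. C-lipschitz_on UNIV f)" "g 0 = 0 \<and> (\<exists>C. C-lipschitz_on UNIV g)"
    then obtain C D where C: "C-lipschitz_on UNIV f" and D: "D-lipschitz_on UNIV g" by blast
    show "lip_const (\<lambda>x. f x + g x) \<le> lip_const f + lip_const g"
    proof (rule lip_const_le)
      fix x y
      have "norm (f x + g x - (f y + g y)) \<le> norm (f x - f y) + norm (g x - g y)"
        using norm_triangle_ineq[of "f x - f y" "g x - g y"] by (simp add: algebra_simps)
      then show "norm (f x + g x - (f y + g y)) \<le> (lip_const f + lip_const g) * dist x y"
        using lip_const_ge[OF C, of x y] lip_const_ge[OF D, of x y] by (simp add: algebra_simps)
    qed (use lip_const_nonneg C D in \<open>fastforce intro: add_nonneg_nonneg\<close>)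
  qed
  have le: "norm (r *\<^sub>R f) \<le> \<bar>r\<bar> * norm f" for r and f :: "('a, 'b) lip0"
  proof transfer
    fix r and f :: "'a \<Rightarrow> 'b"
    assume "f 0 = 0 \<and> (\<exists>C. C-lipschitz_on UNIV f)"
    then obtain C where C: "C-lipschitz_on UNIV f" by blast
    show "lip_const (\<lambda>x. r *\<^sub>R f x) \<le> \<bar>r\<bar> * lip_const f"
    proof (rule lip_const_le)
      fix x y
      show "norm (r *\<^sub>R f x - r *\<^sub>R f y) \<le> \<bar>r\<bar> * lip_const f * dist x y"
        using mult_left_mono[OF lip_const_ge[OF C, of x y], of "\<bar>r\<bar>"]
        by (simp add: scaleR_diff_right[symmetric] mult.assoc)
    qed (use lip_const_nonneg[OF C] in simp)
  qed
  show "norm (r *\<^sub>R f) = \<bar>r\<bar> * norm f"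
  proof (rule antisym[OF le])
    show "\<bar>r\<bar> * norm f \<le> norm (r *\<^sub>R f)"
    proof (cases "r = 0")
      case True
      then have "r *\<^sub>R f = 0" by transfer simp
      moreover have "norm (0 :: ('a, 'b) lip0) = 0"
        by transfer (simp add: lip_const_def case_prod_unfold)
      ultimately show ?thesis using True by simp
    next
      case False
      then have "inverse r *\<^sub>R r *\<^sub>R f = f" by transfer simp
      with le[of "inverse r" "r *\<^sub>R f"] have "norm f \<le> \<bar>inverse r\<bar> * norm (r *\<^sub>R f)" by simp
      with False show ?thesis by (simp add: field_simps)
    qed
  qed
qed

end

lemmas [simp] = zero_lip0.rep_eq plus_lip0.rep_eq scaleR_lip0.rep_eq uminus_lip0.rep_eq
  minus_lip0.rep_eq

lemma lip0_norm_diff_le: "norm (lip0_apply f x - lip0_apply f y) \<le> norm f * dist x y"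
  by transfer (auto intro: lip_const_ge)

lemma lip0_norm_le:
  assumes "\<And>x y. norm (lip0_apply f x - lip0_apply f y) \<le> C * dist x y" "0 \<le> C"
  shows "norm f \<le> C"
  using assms by transfer (rule lip_const_le)


section \<open>The Lipschitz-free space\<close>

lift_definition eval :: "'m::pointed_metric_space \<Rightarrow> ('m, real) lip0 \<Rightarrow>\<^sub>L real"
  is "\<lambda>x f. lip0_apply f x"
proof (rule bounded_linear_intro)
  fix x :: 'm and f :: "('m, real) lip0"
  show "norm (lip0_apply f x) \<le> norm f * dist x 0"
    using lip0_norm_diff_le[of f x 0] by simp
qed simp_all

typedef (overloaded) 'm free_space =
  "closure (span (range (eval :: 'm::pointed_metric_space \<Rightarrow> _)))"
  morphisms free_rep Free_abs
  by (rule exI[of _ 0]) (rule subsetD[OF closure_subset], rule span_zero)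

setup_lifting type_definition_free_space

lemma subspace_free: "subspace (closure (span (range eval)))"
proof (rule subspaceI)
  show "0 \<in> closure (span (range eval))"
    by (rule subsetD[OF closure_subset], rule span_zero)
next
  fix a b :: "('a, real) lip0 \<Rightarrow>\<^sub>L real"
  assume "a \<in> closure (span (range eval))" "b \<in> closure (span (range eval))"
  then obtain u v where u: "\<And>n. u n \<in> span (range eval)" "u \<longlonglongrightarrow> a"
    and v: "\<And>n. v n \<in> span (range eval)" "v \<longlonglongrightarrow> b"
    by (auto simp: closure_sequential)
  have "(\<lambda>n::nat. u n + v n) \<longlonglongrightarrow> a + b" by (rule tendsto_add[OF u(2) v(2)])
  then show "a + b \<in> closure (span (range eval))"
    unfolding closure_sequential
    by (intro exI[of _ "\<lambda>n. u n + v n"] conjI allI span_add u(1) v(1))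
next
  fix c and a :: "('a, real) lip0 \<Rightarrow>\<^sub>L real"
  assume "a \<in> closure (span (range eval))"
  then obtain u where u: "\<And>n. u n \<in> span (range eval)" "u \<longlonglongrightarrow> a"
    by (auto simp: closure_sequential)
  have "(\<lambda>n::nat. c *\<^sub>R u n) \<longlonglongrightarrow> c *\<^sub>R a" by (rule tendsto_scaleR[OF tendsto_const u(2)])
  then show "c *\<^sub>R a \<in> closure (span (range eval))"
    unfolding closure_sequential
    by (intro exI[of _ "\<lambda>n. c *\<^sub>R u n"] conjI allI span_scale u(1))
qed

instantiation free_space :: (pointed_metric_space) real_normed_vector
begin

lift_definition zero_free_space :: "'a free_space" is 0
  by (rule subspace_0[OF subspace_free])

lift_definition plus_free_space :: "'a free_space \<Rightarrow> 'a free_space \<Rightarrow> 'a free_space" is "(+)"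
  by (rule subspace_add[OF subspace_free])

lift_definition scaleR_free_space :: "real \<Rightarrow> 'a free_space \<Rightarrow> 'a free_space" is "scaleR"
  by (rule subspace_scale[OF subspace_free])

lift_definition uminus_free_space :: "'a free_space \<Rightarrow> 'a free_space" is uminus
  by (rule subspace_neg[OF subspace_free])

lift_definition minus_free_space :: "'a free_space \<Rightarrow> 'a free_space \<Rightarrow> 'a free_space" is "(-)"
  by (rule subspace_diff[OF subspace_free])

lift_definition norm_free_space :: "'a free_space \<Rightarrow> real" is norm .

definition dist_free_space :: "'a free_space \<Rightarrow> 'a free_space \<Rightarrow> real"
  where "dist_free_space f g = norm (f - g)"

definition [code del]:
  "(uniformity :: ('a free_space \<times> 'a free_space) filter) =
     (INF e\<in>{0 <..}. principal {(x, y). dist x y < e})"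

definition open_free_space :: "'a free_space set \<Rightarrow> bool"
  where [code del]:
    "open_free_space S = (\<forall>x\<in>S. \<forall>\<^sub>F (x', y) in uniformity. x' = x \<longrightarrow> y \<in> S)"

definition sgn_free_space :: "'a free_space \<Rightarrow> 'a free_space"
  where "sgn_free_space f = scaleR (inverse (norm f)) f"

instance
  apply standard
  unfolding dist_free_space_def open_free_space_def sgn_free_space_def uniformity_free_space_def
  apply (rule refl | (transfer, force simp: norm_triangle_ineq algebra_simps))+
  done

end

lift_definition delta :: "'m::pointed_metric_space \<Rightarrow> 'm free_space" is eval
  by (rule subsetD[OF closure_subset], rule span_base) simp

text \<open>The functional \<open>\<mu> \<mapsto> \<langle>\<mu>, f\<rangle>\<close> on the free space. The map \<open>dual_of_lip\<close> is the canonical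
  identification of \<open>Lip\<^sub>0(M)\<close> with the dual of the free space, and \<open>lip_of_dual\<close> is its inverse
  (see \<open>bij_dual_of_lip\<close> and \<open>norm_dual_of_lip\<close> below).\<close>

lift_definition dual_of_lip :: "('m::pointed_metric_space, real) lip0 \<Rightarrow> 'm free_space \<Rightarrow>\<^sub>L real"
  is "\<lambda>f \<mu>. blinfun_apply (free_rep \<mu>) f"
proof (rule bounded_linear_intro)
  fix f :: "('m, real) lip0" and \<mu> :: "'m free_space"
  show "norm (blinfun_apply (free_rep \<mu>) f) \<le> norm \<mu> * norm f"
    unfolding norm_free_space.rep_eq by (rule norm_blinfun)
qed (simp_all add: plus_free_space.rep_eq scaleR_free_space.rep_eq blinfun.bilinear_simps)

definition lip_of_dual :: "('m::pointed_metric_space free_space \<Rightarrow>\<^sub>L real) \<Rightarrow> ('m, real) lip0"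
  where "lip_of_dual = inv_into UNIV dual_of_lip"

lemma dual_of_lip_delta [simp]: "blinfun_apply (dual_of_lip f) (delta x) = lip0_apply f x"
  by (simp add: dual_of_lip.rep_eq delta.rep_eq eval.rep_eq)

lemma linear_free_rep: "linear free_rep"
  by (rule linearI) (simp_all add: plus_free_space.rep_eq scaleR_free_space.rep_eq)

lemma span_delta_dense:
  "closure (span (range delta)) = (UNIV :: 'm::pointed_metric_space free_space set)"
proof (intro equalityI subset_UNIV subsetI)
  fix \<mu> :: "'m free_space"
  have "span (range eval) = free_rep ` span (range (delta :: 'm \<Rightarrow> _))"
    using linear_span_image[OF linear_free_rep, of "range (delta :: 'm \<Rightarrow> _)"]
    by (simp add: image_image delta.rep_eq)
  then have *: "free_rep \<mu> \<in> closure (free_rep ` span (range delta))"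
    using free_rep[of \<mu>] by simp
  show "\<mu> \<in> closure (span (range delta))"
    unfolding closure_approachable
  proof (intro allI impI)
    fix e :: real
    assume "0 < e"
    with * obtain \<nu> where "\<nu> \<in> span (range delta)" "dist (free_rep \<nu>) (free_rep \<mu>) < e"
      unfolding closure_approachable by blast
    then show "\<exists>\<nu>\<in>span (range delta). dist \<nu> \<mu> < e"
      by (auto simp: dist_norm norm_free_space.rep_eq minus_free_space.rep_eq)
  qed
qed

lemma free_blinfun_eqI:
  fixes S T :: "'m::pointed_metric_space free_space \<Rightarrow>\<^sub>L 'e::real_normed_vector"
  assumes "\<And>x. blinfun_apply S (delta x) = blinfun_apply T (delta x)"
  shows "S = T"
proof (rule blinfun_eqI)
  fix \<mu> :: "'m free_space"
  have "blinfun_apply S \<nu> = blinfun_apply T \<nu>" if "\<nu> \<in> span (range delta)" for \<nu>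
    by (rule linear_eq_on[OF _ _ that])
      (auto simp: assms bounded_linear.linear blinfun.bounded_linear_right)
  then have "span (range delta) \<subseteq> {\<nu>. blinfun_apply S \<nu> = blinfun_apply T \<nu>}"
    by blast
  moreover have "closed {\<nu>. blinfun_apply S \<nu> = blinfun_apply T \<nu>}"
    by (intro closed_Collect_eq linear_continuous_on blinfun.bounded_linear_right)
  ultimately have "closure (span (range delta)) \<subseteq> {\<nu>. blinfun_apply S \<nu> = blinfun_apply T \<nu>}"
    by (rule closure_minimal)
  then show "blinfun_apply S \<mu> = blinfun_apply T \<mu>"
    unfolding span_delta_dense by blast
qed

lemma norm_delta_diff_le: "norm (delta x - delta y) \<le> dist x y"
  unfolding norm_free_space.rep_eq minus_free_space.rep_eq delta.rep_eq
proof (rule norm_blinfun_bound)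
  fix f :: "('a, real) lip0"
  show "norm (blinfun_apply (eval x - eval y) f) \<le> dist x y * norm f"
    using lip0_norm_diff_le[of f x y]
    by (simp add: blinfun.bilinear_simps eval.rep_eq mult.commute)
qed simp

lemma linear_dual_of_lip: "linear dual_of_lip"
  by (rule linearI) (auto intro!: free_blinfun_eqI simp: blinfun.bilinear_simps)

lemma norm_dual_of_lip: "norm (dual_of_lip f) = norm f"
proof (rule antisym)
  show "norm (dual_of_lip f) \<le> norm f"
  proof (rule norm_blinfun_bound)
    fix \<mu> :: "'a free_space"
    show "norm (blinfun_apply (dual_of_lip f) \<mu>) \<le> norm f * norm \<mu>"
      unfolding dual_of_lip.rep_eq norm_free_space.rep_eq
      by (subst mult.commute) (rule norm_blinfun)
  qed simp
  show "norm f \<le> norm (dual_of_lip f)"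
  proof (rule lip0_norm_le)
    fix x y :: 'a
    have "norm (lip0_apply f x - lip0_apply f y)
        = norm (blinfun_apply (dual_of_lip f) (delta x - delta y))"
      by (simp add: blinfun.bilinear_simps)
    also have "\<dots> \<le> norm (dual_of_lip f) * norm (delta x - delta y)"
      by (rule norm_blinfun)
    also have "\<dots> \<le> norm (dual_of_lip f) * dist x y"
      by (intro mult_left_mono norm_delta_diff_le) simp
    finally show "norm (lip0_apply f x - lip0_apply f y) \<le> norm (dual_of_lip f) * dist x y" .
  qed simp
qed

lemma delta_base: "delta 0 = 0"
proof -
  have "eval (0 :: 'a) = 0" by (rule blinfun_eqI) (simp add: eval.rep_eq)
  then show ?thesis by transfer
qed

lemma bij_dual_of_lip: "bij (dual_of_lip :: ('m::pointed_metric_space, real) lip0 \<Rightarrow> _)"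
proof (rule bijI)
  show "inj (dual_of_lip :: ('m, real) lip0 \<Rightarrow> _)"
    by (rule injI, rule lip0_eqI) (metis dual_of_lip_delta)
  show "surj (dual_of_lip :: ('m, real) lip0 \<Rightarrow> _)"
  proof (rule surjI)
    fix \<phi> :: "'m free_space \<Rightarrow>\<^sub>L real"
    let ?f = "Lip0 (\<lambda>x. blinfun_apply \<phi> (delta x))"
    have "(norm \<phi>)-lipschitz_on UNIV (\<lambda>x. blinfun_apply \<phi> (delta x))"
    proof (rule lipschitz_onI)
      fix x y
      have "dist (blinfun_apply \<phi> (delta x)) (blinfun_apply \<phi> (delta y))
          \<le> norm \<phi> * norm (delta x - delta y)"
        unfolding dist_norm blinfun.diff_right[symmetric] by (rule norm_blinfun)
      also have "\<dots> \<le> norm \<phi> * dist x y"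
        by (intro mult_left_mono norm_delta_diff_le) simp
      finally show "dist (blinfun_apply \<phi> (delta x)) (blinfun_apply \<phi> (delta y))
          \<le> norm \<phi> * dist x y" .
    qed simp
    then have "lip0_apply ?f = (\<lambda>x. blinfun_apply \<phi> (delta x))"
      by (intro Lip0_inverse) (auto simp: delta_base)
    then show "dual_of_lip ?f = \<phi>"
      by (intro free_blinfun_eqI) simp
  qed
qed

definition linearization ::
    "('m::pointed_metric_space, 'e::banach) lip0 \<Rightarrow> 'm free_space \<Rightarrow>\<^sub>L 'e" where
  "linearization f = (THE T. \<forall>x. blinfun_apply T (delta x) = lip0_apply f x)"

text \<open>Meaningful only for bounded linear \<open>T\<close>, since \<^const>\<open>Blinfun\<close> is unspecified otherwise.\<close>

definition dual_adjoint ::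
    "('a::real_normed_vector \<Rightarrow> 'b::real_normed_vector) \<Rightarrow> ('b \<Rightarrow>\<^sub>L real) \<Rightarrow> ('a \<Rightarrow>\<^sub>L real)" where
  "dual_adjoint T \<phi> = Blinfun (\<lambda>x. blinfun_apply \<phi> (T x))"

definition surj_linear_isometry ::
    "('a::real_normed_vector \<Rightarrow> 'b::real_normed_vector) \<Rightarrow> bool" where
  "surj_linear_isometry T \<longleftrightarrow> linear T \<and> (\<forall>x. norm (T x) = norm x) \<and> surj T"


section \<open>Quotients of normed spaces\<close>

text \<open>The quotient of a normed space by a closed subspace \<open>Y\<close> depends on the term \<open>Y\<close>, so it
  cannot be a type: it is the set of cosets of \<open>Y\<close> with the operations below. In the scalar
  multiplication \<open>Y\<close> is added so that \<open>0\<close> times a coset is \<open>Y\<close> and not \<open>{0}\<close>.\<close>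

definition quot_map :: "'a::real_normed_vector set \<Rightarrow> 'a \<Rightarrow> 'a set" where
  "quot_map Y x = {x + y | y. y \<in> Y}"

definition quot_space :: "'a::real_normed_vector set \<Rightarrow> 'a set set" where
  "quot_space Y = range (quot_map Y)"

definition quot_add :: "'a::real_normed_vector set \<Rightarrow> 'a set \<Rightarrow> 'a set" where
  "quot_add A B = {a + b | a b. a \<in> A \<and> b \<in> B}"

definition quot_scale :: "'a::real_normed_vector set \<Rightarrow> real \<Rightarrow> 'a set \<Rightarrow> 'a set" where
  "quot_scale Y c A = {c *\<^sub>R a + y | a y. a \<in> A \<and> y \<in> Y}"

definition quot_norm :: "'a::real_normed_vector set \<Rightarrow> real" where
  "quot_norm A = (INF a\<in>A. norm a)"

lemma quot_map_eq_iff: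
  assumes "subspace Y"
  shows "quot_map Y x = quot_map Y x' \<longleftrightarrow> x - x' \<in> Y"
proof
  assume "quot_map Y x = quot_map Y x'"
  moreover have "x \<in> quot_map Y x"
    using subspace_0[OF assms] by (force simp: quot_map_def)
  ultimately show "x - x' \<in> Y"
    by (auto simp: quot_map_def)
next
  have *: "quot_map Y x \<subseteq> quot_map Y x'" if "x - x' \<in> Y" for x x'
  proof
    fix z
    assume "z \<in> quot_map Y x"
    then obtain y where "y \<in> Y" "z = x + y" by (auto simp: quot_map_def)
    then have "z = x' + ((x - x') + y)" "(x - x') + y \<in> Y"
      using subspace_add[OF assms that] by auto
    then show "z \<in> quot_map Y x'" unfolding quot_map_def by blast
  qed
  assume "x - x' \<in> Y"
  then show "quot_map Y x = quot_map Y x'"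
    using *[of x x'] *[of x' x] subspace_neg[OF assms, of "x - x'"] by auto
qed

lemma quot_map_add:
  assumes "subspace Y"
  shows "quot_map Y (x + x') = quot_add (quot_map Y x) (quot_map Y x')"
proof (intro equalityI subsetI)
  fix z
  assume "z \<in> quot_map Y (x + x')"
  then obtain y where "y \<in> Y" "z = (x + y) + (x' + 0)" by (auto simp: quot_map_def algebra_simps)
  then show "z \<in> quot_add (quot_map Y x) (quot_map Y x')"
    using subspace_0[OF assms] unfolding quot_map_def quot_add_def by blast
next
  fix z
  assume "z \<in> quot_add (quot_map Y x) (quot_map Y x')"
  then obtain y y' where "y \<in> Y" "y' \<in> Y" "z = (x + x') + (y + y')"
    by (auto simp: quot_map_def quot_add_def algebra_simps)
  then show "z \<in> quot_map Y (x + x')"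
    using subspace_add[OF assms] unfolding quot_map_def by blast
qed

lemma quot_map_scaleR:
  assumes "subspace Y"
  shows "quot_map Y (c *\<^sub>R x) = quot_scale Y c (quot_map Y x)"
proof (intro equalityI subsetI)
  fix z
  assume "z \<in> quot_map Y (c *\<^sub>R x)"
  then obtain y where "y \<in> Y" "z = c *\<^sub>R (x + 0) + y" by (auto simp: quot_map_def)
  then show "z \<in> quot_scale Y c (quot_map Y x)"
    using subspace_0[OF assms] unfolding quot_map_def quot_scale_def by blast
next
  fix z
  assume "z \<in> quot_scale Y c (quot_map Y x)"
  then obtain y y' where "y \<in> Y" "y' \<in> Y" "z = c *\<^sub>R x + (c *\<^sub>R y + y')"
    by (auto simp: quot_map_def quot_scale_def algebra_simps)
  then show "z \<in> quot_map Y (c *\<^sub>R x)"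
    using subspace_add[OF assms] subspace_scale[OF assms] unfolding quot_map_def by blast
qed

text \<open>Bounded linear operators from the quotient by \<open>Y\<close> to \<open>'b\<close>. As functions on cosets they are
  taken to be \<^const>\<open>undefined\<close> outside \<^term>\<open>quot_space Y\<close>, so that equality of operators is
  equality of functions. The operator norm follows \<^const>\<open>onorm\<close>.\<close>

definition quot_ops :: "'a::real_normed_vector set \<Rightarrow> ('a set \<Rightarrow> 'b::real_normed_vector) set" where
  "quot_ops Y = {T \<in> extensional (quot_space Y).
     (\<forall>A\<in>quot_space Y. \<forall>B\<in>quot_space Y. T (quot_add A B) = T A + T B) \<and>
     (\<forall>c. \<forall>A\<in>quot_space Y. T (quot_scale Y c A) = c *\<^sub>R T A) \<and>
     (\<exists>K. \<forall>A\<in>quot_space Y. norm (T A) \<le> K * quot_norm A)}"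

definition quot_onorm ::
    "'a::real_normed_vector set \<Rightarrow> ('a set \<Rightarrow> 'b::real_normed_vector) \<Rightarrow> real" where
  "quot_onorm Y T = (SUP A\<in>quot_space Y. norm (T A) / quot_norm A)"

definition quot_op_add ::
    "'a::real_normed_vector set \<Rightarrow> ('a set \<Rightarrow> 'b::real_normed_vector) \<Rightarrow> ('a set \<Rightarrow> 'b) \<Rightarrow> 'a set \<Rightarrow> 'b"
  where "quot_op_add Y S T = (\<lambda>A\<in>quot_space Y. S A + T A)"

definition quot_op_scale ::
    "'a::real_normed_vector set \<Rightarrow> real \<Rightarrow> ('a set \<Rightarrow> 'b::real_normed_vector) \<Rightarrow> 'a set \<Rightarrow> 'b"
  where "quot_op_scale Y c T = (\<lambda>A\<in>quot_space Y. c *\<^sub>R T A)"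


section \<open>Actions by similarities\<close>

definition similarity_action ::
    "('g, 'z) monoid_scheme \<Rightarrow> ('g \<Rightarrow> 'm::pointed_metric_space \<Rightarrow> 'm) \<Rightarrow> ('g \<Rightarrow> real) \<Rightarrow> bool" where
  "similarity_action G act chi \<longleftrightarrow>
     group_action G UNIV act \<and>
     (\<forall>g\<in>carrier G. act g 0 = 0 \<and> 0 < chi g \<and> (\<forall>x y. dist (act g x) (act g y) = chi g * dist x y))"

definition lip0_equivariant ::
    "('g, 'z) monoid_scheme \<Rightarrow> ('g \<Rightarrow> 'm \<Rightarrow> 'm) \<Rightarrow> ('g \<Rightarrow> real)
      \<Rightarrow> ('m::pointed_metric_space, 'e::real_normed_vector) lip0 set" where
  "lip0_equivariant G act chi =
     {f. \<forall>g\<in>carrier G. \<forall>x. lip0_apply f (act g x) = chi g *\<^sub>R lip0_apply f x}"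

definition lip_U ::
    "('g, 'z) monoid_scheme \<Rightarrow> ('g \<Rightarrow> 'm \<Rightarrow> 'm) \<Rightarrow> ('g \<Rightarrow> real) \<Rightarrow> 'g
      \<Rightarrow> ('m::pointed_metric_space, real) lip0 \<Rightarrow> ('m, real) lip0" where
  "lip_U G act chi g f = Lip0 (\<lambda>x. chi g * lip0_apply f (act (inv\<^bsub>G\<^esub> g) x))"

definition is_free_V ::
    "('g \<Rightarrow> 'm \<Rightarrow> 'm) \<Rightarrow> ('g \<Rightarrow> real) \<Rightarrow> 'g
      \<Rightarrow> ('m::pointed_metric_space free_space \<Rightarrow> 'm free_space) \<Rightarrow> bool" where
  "is_free_V act chi g V \<longleftrightarrow>
     surj_linear_isometry V \<and> (\<forall>x. V (delta x) = inverse (chi g) *\<^sub>R delta (act g x))"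

definition free_V ::
    "('g \<Rightarrow> 'm \<Rightarrow> 'm) \<Rightarrow> ('g \<Rightarrow> real) \<Rightarrow> 'g
      \<Rightarrow> 'm::pointed_metric_space free_space \<Rightarrow> 'm free_space" where
  "free_V act chi g = (THE V. is_free_V act chi g V)"

definition similarity_Y ::
    "('g, 'z) monoid_scheme \<Rightarrow> ('g \<Rightarrow> 'm \<Rightarrow> 'm) \<Rightarrow> ('g \<Rightarrow> real)
      \<Rightarrow> 'm::pointed_metric_space free_space set" where
  "similarity_Y G act chi =
     closure (span {delta (act g x) - chi g *\<^sub>R delta x | g x. g \<in> carrier G})"

definition lip_annihilator ::
    "'m::pointed_metric_space free_space set \<Rightarrow> ('m, real) lip0 set" where
  "lip_annihilator S = {f. \<forall>\<mu>\<in>S. blinfun_apply (dual_of_lip f) \<mu> = 0}"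

text \<open>The adjoint of the quotient map, composed with the identification of the dual of the free
  space with \<open>Lip\<^sub>0(M)\<close>.\<close>

definition quot_map_adjoint ::
    "'m::pointed_metric_space free_space set \<Rightarrow> ('m free_space set \<Rightarrow> real) \<Rightarrow> ('m, real) lip0" where
  "quot_map_adjoint Y \<phi> = lip_of_dual (Blinfun (\<lambda>\<mu>. \<phi> (quot_map Y \<mu>)))"

definition quot_lift ::
    "'m free_space set \<Rightarrow> ('m::pointed_metric_space, 'e::real_normed_vector) lip0
      \<Rightarrow> 'm free_space set \<Rightarrow> 'e" where
  "quot_lift Y f = (THE T. T \<in> quot_ops Y \<and> (\<forall>x. T (quot_map Y (delta x)) = lip0_apply f x))"

end

theory Submission
  imports Defs
begin

text \<open>Everything rests on the universal property of the free space: a Lipschitz map \<open>f\<close> with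
  \<open>f(0) = 0\<close> into a Banach space \<open>E\<close> extends to a bounded operator \<open>linearization f\<close> with
  \<open>\<delta>\<^sub>x \<mapsto> f(x)\<close> and norm \<open>Lip(f)\<close>. The point is the estimate \<open>\<parallel>v\<parallel> \<le> Lip(f) \<parallel>\<mu>\<parallel>\<close> for
  \<open>\<mu> = \<Sum> a\<^sub>i \<delta>\<^sub>x\<^sub>i\<close> and \<open>v = \<Sum> a\<^sub>i f(x\<^sub>i)\<close>. The norm of the free space is defined by duality with real
  Lipschitz functions, so the estimate is tested with a functional \<open>\<phi>\<close> norming \<open>v\<close>: the function
  \<open>\<phi> \<circ> f\<close> is real valued, its Lipschitz constant is at most \<open>Lip(f)\<close>, and it pairs with \<open>\<mu>\<close> to
  \<open>\<phi>(v) = \<parallel>v\<parallel>\<close>. This is where the Hahn--Banach theorem enters (\<open>norming_functional\<close>,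
  \<open>free_space_norm_bound_on_graph\<close>, \<open>ex_linearization\<close>).

  The group acts on the free space by linearizing \<open>x \<mapsto> \<chi>(g)\<^sup>-\<^sup>1 \<delta>\<^sub>g\<^sub>x\<close>. The factor
  \<open>\<chi>(g)\<^sup>-\<^sup>1\<close> cancels the dilation, so this map is nonexpansive, and \<open>V\<^sub>g\<close> has norm at most one.
  Since \<open>\<chi>\<close> is multiplicative (two distinct points detect this), the operators for \<open>g\<close> and for
  the inverse of \<open>g\<close> are mutually inverse contractions, hence isometries. The same argument applies to \<open>U\<^sub>g\<close>. All
  identities between operators on the free space are checked on the points \<open>\<delta>\<^sub>x\<close>, whose span is
  dense.

  The rest is the duality between subspaces and quotients. For any subspace \<open>Y\<close>, operators on the
  quotient by \<open>Y\<close> are the same as operators that vanish on \<open>Y\<close>, with the same norm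
  (\<open>quot_onorm_eq_norm_pullback\<close>). Composed with linearization this identifies them with the
  Lipschitz maps whose linearization kills \<open>Y\<close> (\<open>bij_quot_lift\<close>). For the closed span of the
  vectors \<open>\<delta>\<^sub>g\<^sub>x - \<chi>(g) \<delta>\<^sub>x\<close> these are exactly the equivariant maps (\<open>lip_vanishing_Y\<close>). The
  annihilator and the range of the adjoint of the quotient map are the case \<open>E = \<real>\<close>.\<close>

section \<open>Norming functionals\<close>

text \<open>A minimal sublinear functional is linear, so Zorn's lemma yields a linear functional below any
  sublinear one. Homogeneity is required as an inequality, which is all that has to be checked for
  infima; applying it to \<open>c\<close> and \<open>1/c\<close> gives equality.\<close>

definition sublinear :: "('e::real_vector \<Rightarrow> real) \<Rightarrow> bool" where
  "sublinear p \<longleftrightarrow> (\<forall>x y. p (x + y) \<le> p x + p y) \<and> (\<forall>c>0. \<forall>x. p (c *\<^sub>R x) \<le> c * p x)"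

lemma sublinear_add: "sublinear p \<Longrightarrow> p (x + y) \<le> p x + p y"
  by (simp add: sublinear_def)

lemma sublinear_scaleR_le: "sublinear p \<Longrightarrow> 0 < c \<Longrightarrow> p (c *\<^sub>R x) \<le> c * p x"
  by (simp add: sublinear_def)

lemma sublinear_scaleR:
  assumes "sublinear p" "0 < c"
  shows "p (c *\<^sub>R x) = c * p x"
proof (rule antisym[OF sublinear_scaleR_le[OF assms]])
  have "p x \<le> inverse c * p (c *\<^sub>R x)"
    using sublinear_scaleR_le[OF assms(1), of "inverse c" "c *\<^sub>R x"] assms(2) by simp
  then show "c * p x \<le> p (c *\<^sub>R x)"
    using assms(2) by (simp add: field_simps)
qed

lemma sublinear_zero: "sublinear p \<Longrightarrow> p 0 = 0"
  using sublinear_scaleR[of p 2 0] by simp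

lemma sublinear_ge: "sublinear p \<Longrightarrow> - p (- x) \<le> p x"
  using sublinear_add[of p x "- x"] sublinear_zero[of p] by simp

lemma sublinear_norm: "sublinear norm"
  by (auto simp: sublinear_def norm_triangle_ineq)

text \<open>The largest sublinear functional below \<open>p\<close> whose value at \<open>-y\<close> is at most \<open>-p(y)\<close>. It serves
  twice: a minimal \<open>p\<close> equals all its tilts, which forces additivity, and a linear functional below
  the tilt of the norm in the direction \<open>v\<close> attains its norm at \<open>v\<close>.\<close>

definition tilt :: "('e::real_vector \<Rightarrow> real) \<Rightarrow> 'e \<Rightarrow> 'e \<Rightarrow> real" where
  "tilt p y x = (INF t\<in>{0..}. p (x + t *\<^sub>R y) - t * p y)"

lemma tilt_le:
  assumes "sublinear p" "0 \<le> t"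
  shows "tilt p y x \<le> p (x + t *\<^sub>R y) - t * p y"
proof -
  have "- p (- x) \<le> p (x + s *\<^sub>R y) - s * p y" if "0 \<le> s" for s
  proof (cases "s = 0")
    case False
    then show ?thesis
      using sublinear_add[OF assms(1), of "x + s *\<^sub>R y" "- x"] sublinear_scaleR[OF assms(1), of s y]
        that by (simp add: algebra_simps)
  qed (simp add: sublinear_ge assms)
  then have "bdd_below ((\<lambda>t. p (x + t *\<^sub>R y) - t * p y) ` {0..})"
    by (intro bdd_belowI2[of _ "- p (- x)"]) auto
  then show ?thesis
    unfolding tilt_def using assms(2) by (intro cINF_lower) auto
qed

lemma sublinear_tilt:
  assumes "sublinear p"
  shows "sublinear (tilt p y)"
  unfolding sublinear_def
proof (intro conjI allI impI)
  fix x x'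
  have "tilt p y (x + x') - (p (x + t *\<^sub>R y) - t * p y) \<le> tilt p y x'" if t: "0 \<le> t" for t
    unfolding tilt_def[of p y x']
  proof (rule cINF_greatest)
    fix s :: real
    assume "s \<in> {0..}"
    with t have "tilt p y (x + x') \<le> p ((x + t *\<^sub>R y) + (x' + s *\<^sub>R y)) - (t + s) * p y"
      using tilt_le[OF assms, of "t + s" y "x + x'"] by (simp add: algebra_simps)
    then show "tilt p y (x + x') - (p (x + t *\<^sub>R y) - t * p y) \<le> p (x' + s *\<^sub>R y) - s * p y"
      using sublinear_add[OF assms, of "x + t *\<^sub>R y" "x' + s *\<^sub>R y"]
      by (simp add: algebra_simps)
  qed simp
  then have "tilt p y (x + x') - tilt p y x' \<le> tilt p y x"
    unfolding tilt_def[of p y x] by (intro cINF_greatest) (auto simp: algebra_simps)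
  then show "tilt p y (x + x') \<le> tilt p y x + tilt p y x'" by simp
next
  fix c :: real and x
  assume c: "0 < c"
  have "tilt p y (c *\<^sub>R x) / c \<le> tilt p y x"
    unfolding tilt_def[of p y x]
  proof (rule cINF_greatest)
    fix t :: real
    assume "t \<in> {0..}"
    with c have "tilt p y (c *\<^sub>R x) \<le> p (c *\<^sub>R (x + t *\<^sub>R y)) - c * t * p y"
      using tilt_le[OF assms, of "c * t" y "c *\<^sub>R x"] by (simp add: scaleR_add_right)
    also have "\<dots> = c * (p (x + t *\<^sub>R y) - t * p y)"
      using sublinear_scaleR[OF assms c, of "x + t *\<^sub>R y"] by (simp add: right_diff_distrib)
    finally show "tilt p y (c *\<^sub>R x) / c \<le> p (x + t *\<^sub>R y) - t * p y"
      using c by (simp add: field_simps)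
  qed simp
  then show "tilt p y (c *\<^sub>R x) \<le> c * tilt p y x"
    using c by (simp add: field_simps)
qed

text \<open>Minimality gives \<open>tilt p y = p\<close>, and the term \<open>t = 1\<close> of the infimum then reads
  \<open>p(x) \<le> p(x + y) - p(y)\<close>, the converse of subadditivity.\<close>

lemma linear_if_minimal_sublinear:
  assumes p: "sublinear p"
    and minimal: "\<And>q. sublinear q \<Longrightarrow> (\<And>x. q x \<le> p x) \<Longrightarrow> q = p"
  shows "linear p"
proof -
  have "tilt p y = p" for y
    using tilt_le[OF p, of 0 y] by (intro minimal sublinear_tilt p) simp
  then have "p x \<le> p (x + y) - p y" for x y
    using tilt_le[OF p, of 1 y x] by simp
  then have add: "p (x + y) = p x + p y" for x y
    using sublinear_add[OF p, of x y] by (simp add: antisym algebra_simps)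
  have neg: "p (- x) = - p x" for x
    using add[of x "- x"] sublinear_zero[OF p] by simp
  show ?thesis
  proof (rule linearI[OF add])
    fix c :: real and x
    consider "c = 0" | "0 < c" | "0 < - c" by linarith
    then show "p (c *\<^sub>R x) = c *\<^sub>R p x"
    proof cases
      case 3
      then show ?thesis
        using sublinear_scaleR[OF p, of "- c" x] neg[of "c *\<^sub>R x"] by simp
    qed (simp_all add: sublinear_zero[OF p] sublinear_scaleR[OF p])
  qed
qed

text \<open>The infimum is finite because every sublinear \<open>p \<le> p\<^sub>0\<close> satisfies
  \<open>p(x) \<ge> -p(-x) \<ge> -p\<^sub>0(-x)\<close>. Comparability of the members is needed for subadditivity, where
  near-optimal members for \<open>x\<close> and for \<open>y\<close> have to be replaced by a single one.\<close>

lemma sublinear_INF_chain: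
  assumes "C \<noteq> {}"
    and C: "C \<subseteq> {p. sublinear p \<and> p \<le> p\<^sub>0}"
    and chain: "\<forall>p\<in>C. \<forall>q\<in>C. p \<le> q \<or> q \<le> p"
  shows "sublinear (\<lambda>x. INF p\<in>C. p x)"
    and "\<forall>p\<in>C. (\<lambda>x. INF p\<in>C. p x) \<le> p"
proof -
  have sub: "sublinear p" if "p \<in> C" for p
    using C that by auto
  have ge: "- p\<^sub>0 (- x) \<le> p x" if "p \<in> C" for p x
  proof -
    have "p (- x) \<le> p\<^sub>0 (- x)"
      using C that by (auto simp: le_fun_def)
    then show ?thesis
      using sublinear_ge[OF sub[OF that], of x] by linarith
  qed
  have lower: "(INF p\<in>C. p x) \<le> p x" if "p \<in> C" for p x
    using that ge by (intro cINF_lower bdd_belowI2[of _ "- p\<^sub>0 (- x)"]) auto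
  then show "\<forall>p\<in>C. (\<lambda>x. INF p\<in>C. p x) \<le> p"
    by (simp add: le_fun_def)
  show "sublinear (\<lambda>x. INF p\<in>C. p x)"
    unfolding sublinear_def
  proof (intro conjI allI impI)
    fix x y
    have *: "(INF p\<in>C. p (x + y)) \<le> p x + q y" if pq: "p \<in> C" "q \<in> C" for p q
    proof -
      from chain pq obtain r where "r \<in> C" "r \<le> p" "r \<le> q" by blast
      then show ?thesis
        using lower[of r "x + y"] sublinear_add[OF sub[of r], of x y] le_funD[of r p x]
          le_funD[of r q y]
        by linarith
    qed
    have "(INF p\<in>C. p (x + y)) - p x \<le> (INF p\<in>C. p y)" if "p \<in> C" for p
    proof (rule cINF_greatest[OF assms(1)])
      show "(INF p\<in>C. p (x + y)) - p x \<le> q y" if "q \<in> C" for q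
        using *[OF \<open>p \<in> C\<close> that] by simp
    qed
    then have "(INF p\<in>C. p (x + y)) - (INF p\<in>C. p y) \<le> (INF p\<in>C. p x)"
      by (intro cINF_greatest[OF assms(1)]) (simp add: diff_le_eq add.commute)
    then show "(INF p\<in>C. p (x + y)) \<le> (INF p\<in>C. p x) + (INF p\<in>C. p y)" by simp
  next
    fix c :: real and x
    assume c: "0 < c"
    have "(INF p\<in>C. p (c *\<^sub>R x)) / c \<le> (INF p\<in>C. p x)"
    proof (rule cINF_greatest[OF assms(1)])
      fix p
      assume "p \<in> C"
      then have "(INF p\<in>C. p (c *\<^sub>R x)) \<le> c * p x"
        using lower[of p "c *\<^sub>R x"] sublinear_scaleR[OF sub c, of p x] by simp
      then show "(INF p\<in>C. p (c *\<^sub>R x)) / c \<le> p x" using c by (simp add: field_simps)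
    qed
    then show "(INF p\<in>C. p (c *\<^sub>R x)) \<le> c * (INF p\<in>C. p x)"
      using c by (simp add: field_simps)
  qed
qed

lemma linear_below_sublinear:
  assumes p\<^sub>0: "sublinear p\<^sub>0"
  obtains \<phi> where "linear \<phi>" "\<And>x. \<phi> x \<le> p\<^sub>0 x"
proof -
  let ?A = "{p. sublinear p \<and> p \<le> p\<^sub>0}"
  have "\<exists>p\<in>?A. \<forall>q\<in>?A. q \<le> p \<longrightarrow> q = p"
  proof (rule predicate_Zorn)
    show "partial_order_on ?A (relation_of (\<lambda>p q. q \<le> p) ?A)"
      by (rule partial_order_on_relation_ofI) auto
  next
    fix C
    assume "C \<in> Chains (relation_of (\<lambda>p q. q \<le> p) ?A)"
    then have C: "C \<subseteq> ?A" "\<forall>p\<in>C. \<forall>q\<in>C. p \<le> q \<or> q \<le> p"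
      by (auto simp: Chains_def relation_of_def)
    show "\<exists>u\<in>?A. \<forall>a\<in>C. u \<le> a"
    proof (cases "C = {}")
      case False
      note inf = sublinear_INF_chain[OF False C]
      have "(\<lambda>x. INF p\<in>C. p x) \<le> p\<^sub>0"
      proof -
        obtain p where "p \<in> C"
          using False by blast
        then show ?thesis
          using inf(2) C(1) order_trans[of "\<lambda>x. INF p\<in>C. p x" p p\<^sub>0] by auto
      qed
      with inf(1) have "(\<lambda>x. INF p\<in>C. p x) \<in> ?A" by simp
      with inf(2) show ?thesis by (rule rev_bexI[rotated])
    qed (use p\<^sub>0 in \<open>auto intro!: exI[of _ p\<^sub>0]\<close>)
  qed
  then obtain p where "p \<in> ?A" and min: "\<forall>q\<in>?A. q \<le> p \<longrightarrow> q = p" ..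
  then have p: "sublinear p" "p \<le> p\<^sub>0" by simp_all
  have "linear p"
  proof (rule linear_if_minimal_sublinear[OF p(1)])
    fix q
    assume q: "sublinear q" "\<And>x. q x \<le> p x"
    then have "q \<le> p" by (simp add: le_fun_def)
    with q(1) p(2) min show "q = p" by simp
  qed
  then show thesis
    using p(2) by (intro that) (auto simp: le_fun_def)
qed

text \<open>Bounding a functional by the tilted norm gives \<open>\<phi>(-v) \<le> -\<parallel>v\<parallel>\<close> besides \<open>\<phi> \<le> \<parallel>\<cdot>\<parallel>\<close>, so no
  prior functional on the line through \<open>v\<close> has to be extended.\<close>

lemma norming_functional:
  fixes v :: "'e::real_normed_vector"
  obtains \<phi> :: "'e \<Rightarrow>\<^sub>L real" where "norm \<phi> \<le> 1" "blinfun_apply \<phi> v = norm v"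
proof -
  obtain \<phi> where \<phi>: "linear \<phi>" "\<And>x. \<phi> x \<le> tilt norm v x"
    using linear_below_sublinear[OF sublinear_tilt[OF sublinear_norm, of v]] by blast
  have le: "\<phi> x \<le> norm x" for x
    using \<phi>(2)[of x] tilt_le[OF sublinear_norm, of 0 v x] by simp
  have abs: "\<bar>\<phi> x\<bar> \<le> norm x" for x
    using le[of x] le[of "- x"] by (simp add: linear_neg[OF \<phi>(1)])
  then have bl: "bounded_linear \<phi>"
    using \<phi>(1) by (intro bounded_linear_intro[of _ 1]) (auto simp: linear_add linear_scale)
  have "\<phi> (- v) \<le> - norm v"
    using \<phi>(2)[of "- v"] tilt_le[OF sublinear_norm, of 1 v "- v"] by simp
  then have "\<phi> v = norm v"
    using le[of v] by (simp add: linear_neg[OF \<phi>(1)])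
  then show thesis
    using abs by (intro that[of "Blinfun \<phi>"] norm_blinfun_bound)
      (auto simp: bounded_linear_Blinfun_apply[OF bl])
qed


section \<open>Linearization\<close>

lemma subspace_closure:
  fixes S :: "'a::real_normed_vector set"
  assumes "subspace S"
  shows "subspace (closure S)"
proof (rule subspaceI)
  show "0 \<in> closure S"
    using subspace_0[OF assms] closure_subset by blast
next
  fix a b
  assume "a \<in> closure S" "b \<in> closure S"
  then obtain u v where u: "\<And>n. u n \<in> S" "u \<longlonglongrightarrow> a" and v: "\<And>n. v n \<in> S" "v \<longlonglongrightarrow> b"
    by (auto simp: closure_sequential)
  then show "a + b \<in> closure S"
    unfolding closure_sequential
    by (intro exI[of _ "\<lambda>n. u n + v n"] conjI allI subspace_add[OF assms] tendsto_add)
next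
  fix c a
  assume "a \<in> closure S"
  then obtain u where "\<And>n. u n \<in> S" "u \<longlonglongrightarrow> a"
    by (auto simp: closure_sequential)
  then show "c *\<^sub>R a \<in> closure S"
    unfolding closure_sequential
    by (intro exI[of _ "\<lambda>n. c *\<^sub>R u n"] conjI allI subspace_scale[OF assms] tendsto_intros)
qed

text \<open>Completeness lets the free space itself be the target of a linearization, which is how the
  operators \<open>V\<^sub>g\<close> arise.\<close>

instance free_space :: (pointed_metric_space) banach
proof
  fix X :: "nat \<Rightarrow> 'a free_space"
  assume "Cauchy X"
  then have "Cauchy (\<lambda>n. free_rep (X n))"
    by (simp add: Cauchy_def dist_norm norm_free_space.rep_eq minus_free_space.rep_eq)
  then obtain l where l: "(\<lambda>n. free_rep (X n)) \<longlonglongrightarrow> l"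
    using Cauchy_convergent_iff convergent_def by blast
  then have "l \<in> closure (span (range eval))"
    by (rule Lim_in_closed_set[OF closed_closure always_eventually, rotated 2])
      (simp_all add: free_rep)
  then obtain \<mu> where "l = free_rep \<mu>"
    by (metis Free_abs_inverse)
  with l have "X \<longlonglongrightarrow> \<mu>"
    by (simp add: LIMSEQ_iff norm_free_space.rep_eq minus_free_space.rep_eq)
  then show "convergent X" by (rule convergentI)
qed

lemma Lip0_apply:
  assumes "f 0 = 0" "\<And>x y. norm (f x - f y) \<le> C * dist x y" "0 \<le> C"
  shows "lip0_apply (Lip0 f) = f"
  using assms by (intro Lip0_inverse) (auto simp: lipschitz_on_def dist_norm)

lemma norm_lip0_eq: "norm f = lip_const (lip0_apply f)"
  by (rule norm_lip0.rep_eq)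

text \<open>Working with the span of the pairs \<open>(\<delta>\<^sub>x, f(x))\<close> avoids choosing a representation of \<open>\<mu>\<close> as a
  combination of points: that the value \<open>v\<close> depends on \<open>\<mu>\<close> alone is the case \<open>\<mu> = 0\<close> of the
  estimate. With \<open>\<phi>\<close> norming \<open>v\<close> and \<open>h = \<phi> \<circ> f\<close>, one has
  \<open>\<parallel>v\<parallel> = \<phi>(v) = \<langle>\<mu>, h\<rangle> \<le> Lip(h) \<parallel>\<mu>\<parallel>\<close>.\<close>

lemma free_space_norm_bound_on_graph:
  fixes f :: "('m::pointed_metric_space, 'e::real_normed_vector) lip0"
  assumes "(\<mu>, v) \<in> span (range (\<lambda>x. (delta x, lip0_apply f x)))"
  shows "norm v \<le> norm f * norm \<mu>"
proof -
  obtain \<phi> :: "'e \<Rightarrow>\<^sub>L real" where \<phi>: "norm \<phi> \<le> 1" "blinfun_apply \<phi> v = norm v"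
    by (rule norming_functional)
  let ?h = "Lip0 (\<lambda>x. blinfun_apply \<phi> (lip0_apply f x))"
  have lip: "norm (blinfun_apply \<phi> (lip0_apply f x) - blinfun_apply \<phi> (lip0_apply f y))
      \<le> norm f * dist x y" for x y
  proof -
    have "norm (blinfun_apply \<phi> (lip0_apply f x - lip0_apply f y))
        \<le> norm \<phi> * norm (lip0_apply f x - lip0_apply f y)" by (rule norm_blinfun)
    also have "\<dots> \<le> 1 * (norm f * dist x y)"
      using \<phi>(1) by (intro mult_mono lip0_norm_diff_le) auto
    finally show ?thesis by (simp add: blinfun.diff_right)
  qed
  then have h: "lip0_apply ?h = (\<lambda>x. blinfun_apply \<phi> (lip0_apply f x))"
    by (intro Lip0_apply) auto
  with lip have "norm ?h \<le> norm f"
    by (intro lip0_norm_le) auto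
  have "blinfun_apply (dual_of_lip ?h) (fst p) = blinfun_apply \<phi> (snd p)"
    if "p \<in> span (range (\<lambda>x. (delta x, lip0_apply f x)))" for p
    by (rule linear_eq_on[OF _ _ that])
      (auto simp: h intro!: linearI simp: blinfun.bilinear_simps)
  from this[OF assms] \<phi>(2) have "norm v = blinfun_apply (dual_of_lip ?h) \<mu>" by simp
  also have "\<dots> \<le> norm ?h * norm \<mu>"
    using norm_blinfun[of "dual_of_lip ?h" \<mu>] by (simp add: norm_dual_of_lip)
  also have "\<dots> \<le> norm f * norm \<mu>"
    by (rule mult_right_mono) (use \<open>norm ?h \<le> norm f\<close> in auto)
  finally show ?thesis .
qed

text \<open>The closure of the span of the pairs \<open>(\<delta>\<^sub>x, f(x))\<close> is the graph of the linearization: the norm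
  estimate passes to the closure and makes it single valued, and density of the span of the
  \<open>\<delta>\<^sub>x\<close> with completeness of \<open>E\<close> makes it everywhere defined.\<close>

lemma ex_linearization:
  fixes f :: "('m::pointed_metric_space, 'e::banach) lip0"
  obtains T :: "'m free_space \<Rightarrow>\<^sub>L 'e"
  where "\<And>x. blinfun_apply T (delta x) = lip0_apply f x" "norm T \<le> norm f"
proof -
  define W where "W = span (range (\<lambda>x. (delta x, lip0_apply f x)))"
  have W: "subspace (closure W)"
    unfolding W_def by (intro subspace_closure subspace_span)
  have bound: "norm v \<le> norm f * norm \<mu>" if "(\<mu>, v) \<in> closure W" for \<mu> v
  proof -
    have "closed {p. norm (snd p) \<le> norm f * norm (fst p)}" for f :: "('m, 'e) lip0"
      by (intro closed_Collect_le continuous_intros)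
    then have "closure W \<subseteq> {p. norm (snd p) \<le> norm f * norm (fst p)}"
      unfolding W_def by (intro closure_minimal) (auto intro: free_space_norm_bound_on_graph)
    with that show ?thesis by auto
  qed
  have ex: "\<exists>v. (\<mu>, v) \<in> closure W" for \<mu>
  proof -
    have "fst ` W = span (range delta)"
      unfolding W_def using linear_span_image[OF linear_fst, of "range (\<lambda>x. (delta x, lip0_apply f x))"]
      by (simp add: image_image)
    then have "\<mu> \<in> closure (fst ` W)"
      by (simp add: span_delta_dense)
    then obtain m where m: "\<And>n. m n \<in> fst ` W" "m \<longlonglongrightarrow> \<mu>"
      by (auto simp: closure_sequential)
    have "\<exists>u. (m n, u) \<in> W" for n
      using m(1)[of n] by auto
    then obtain u where u: "\<And>n. (m n, u n) \<in> W" by metis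
    have "Cauchy u"
    proof (rule CauchyI)
      fix e :: real
      assume "0 < e"
      \<comment> \<open>one is added because \<open>norm f\<close> may be zero\<close>
      then have "0 < e / (norm f + 1)" by (simp add: add_nonneg_pos)
      then obtain N where N: "\<And>i j. i \<ge> N \<Longrightarrow> j \<ge> N \<Longrightarrow> norm (m i - m j) < e / (norm f + 1)"
        using CauchyD[OF LIMSEQ_imp_Cauchy[OF m(2)]] by blast
      have "norm (u i - u j) < e" if "i \<ge> N" "j \<ge> N" for i j
      proof -
        have "(m i - m j, u i - u j) \<in> closure W"
          using subspace_diff[OF W, of "(m i, u i)" "(m j, u j)"] u closure_subset by auto
        then have "norm (u i - u j) \<le> norm f * norm (m i - m j)"
          by (rule bound)
        also have "\<dots> \<le> (norm f + 1) * norm (m i - m j)"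
          by (intro mult_right_mono) auto
        also have "\<dots> < e"
          using N[OF that] by (simp add: pos_less_divide_eq add_nonneg_pos mult.commute)
        finally show ?thesis .
      qed
      then show "\<exists>N. \<forall>i\<ge>N. \<forall>j\<ge>N. norm (u i - u j) < e" by blast
    qed
    then obtain v where "u \<longlonglongrightarrow> v"
      using Cauchy_convergent_iff convergent_def by blast
    then have "(\<lambda>n. (m n, u n)) \<longlonglongrightarrow> (\<mu>, v)"
      using m(2) by (rule tendsto_Pair[rotated])
    with u have "(\<mu>, v) \<in> closure W"
      unfolding closure_sequential by (intro exI[of _ "\<lambda>n. (m n, u n)"]) simp
    then show ?thesis ..
  qed
  have unique: "v = w" if "(\<mu>, v) \<in> closure W" "(\<mu>, w) \<in> closure W" for \<mu> v w
    using bound[of 0 "v - w"] subspace_diff[OF W that] by simp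
  obtain T where T: "\<And>\<mu>. (\<mu>, T \<mu>) \<in> closure W"
    using ex by metis
  have bl: "bounded_linear T"
  proof (rule bounded_linear_intro)
    show "T (\<mu> + \<nu>) = T \<mu> + T \<nu>" for \<mu> \<nu>
      using subspace_add[OF W T[of \<mu>] T[of \<nu>]] by (intro unique[OF T]) simp
    show "T (c *\<^sub>R \<mu>) = c *\<^sub>R T \<mu>" for c \<mu>
      using subspace_scale[OF W T[of \<mu>], of c] by (intro unique[OF T]) simp
    show "norm (T \<mu>) \<le> norm \<mu> * norm f" for \<mu>
      using bound[OF T[of \<mu>]] by (simp add: mult.commute)
  qed
  have "T (delta x) = lip0_apply f x" for x
    by (rule unique[OF T], rule subsetD[OF closure_subset]) (auto simp: W_def intro: span_base)
  then show thesis
    using bound[OF T] by (intro that[of "Blinfun T"] norm_blinfun_bound)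
      (auto simp: bounded_linear_Blinfun_apply[OF bl])
qed

lemma linearization_eqI:
  assumes "\<And>x. blinfun_apply T (delta x) = lip0_apply f x"
  shows "linearization f = T"
  unfolding linearization_def
  by (rule the_equality) (auto simp: assms intro!: free_blinfun_eqI)

lemma linearization_delta [simp]: "blinfun_apply (linearization f) (delta x) = lip0_apply f x"
  by (metis ex_linearization linearization_eqI)

lemma norm_linearization: "norm (linearization f) = norm f"
proof (rule antisym)
  show "norm (linearization f) \<le> norm f"
    by (metis ex_linearization linearization_eqI)
  show "norm f \<le> norm (linearization f)"
  proof (rule lip0_norm_le)
    fix x y
    have "norm (lip0_apply f x - lip0_apply f y)
        = norm (blinfun_apply (linearization f) (delta x - delta y))"
      by (simp add: blinfun.diff_right)
    also have "\<dots> \<le> norm (linearization f) * norm (delta x - delta y)"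
      by (rule norm_blinfun)
    also have "\<dots> \<le> norm (linearization f) * dist x y"
      by (intro mult_left_mono norm_delta_diff_le) simp
    finally show "norm (lip0_apply f x - lip0_apply f y) \<le> norm (linearization f) * dist x y" .
  qed simp
qed


section \<open>Operators on a quotient\<close>

text \<open>For \<open>S\<close> vanishing on \<open>Y\<close>, the operator on cosets through which \<open>S\<close> factors. The chosen
  representative does not matter then. The inverse construction is composition with the quotient
  map.\<close>

definition quot_factor ::
    "'a::real_normed_vector set \<Rightarrow> ('a \<Rightarrow>\<^sub>L 'b::real_normed_vector) \<Rightarrow> 'a set \<Rightarrow> 'b" where
  "quot_factor Y S = (\<lambda>A\<in>quot_space Y. blinfun_apply S (SOME a. a \<in> A))"

definition quot_pullback ::
    "'a::real_normed_vector set \<Rightarrow> ('a set \<Rightarrow> 'b::real_normed_vector) \<Rightarrow> 'a \<Rightarrow>\<^sub>L 'b" where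
  "quot_pullback Y T = Blinfun (\<lambda>x. T (quot_map Y x))"

lemma quot_map_in_quot_space [simp]: "quot_map Y x \<in> quot_space Y"
  by (simp add: quot_space_def)

lemma in_quot_map:
  assumes "subspace Y"
  shows "x \<in> quot_map Y x"
  using subspace_0[OF assms] by (force simp: quot_map_def)

lemma quot_ops_eqI:
  assumes "S \<in> quot_ops Y" "T \<in> quot_ops Y" "\<And>x. S (quot_map Y x) = T (quot_map Y x)"
  shows "S = T"
  using assms by (intro extensionalityI[of _ "quot_space Y"]) (auto simp: quot_ops_def quot_space_def)

lemma quot_factor_quot_map:
  assumes Y: "subspace Y" and S: "\<And>y. y \<in> Y \<Longrightarrow> blinfun_apply S y = 0"
  shows "quot_factor Y S (quot_map Y x) = blinfun_apply S x"
proof -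
  have "(SOME a. a \<in> quot_map Y x) \<in> quot_map Y x"
    using in_quot_map[OF Y] by (rule someI)
  then obtain y where "y \<in> Y" "(SOME a. a \<in> quot_map Y x) = x + y"
    by (auto simp: quot_map_def)
  then show ?thesis
    using S by (simp add: quot_factor_def blinfun.add_right)
qed

lemma quot_norm_nonneg: "subspace Y \<Longrightarrow> 0 \<le> quot_norm (quot_map Y x)"
  unfolding quot_norm_def using in_quot_map by (intro cINF_greatest) auto

lemma quot_norm_le: "a \<in> A \<Longrightarrow> quot_norm A \<le> norm a"
  unfolding quot_norm_def by (rule cINF_lower) (auto intro: bdd_belowI2[of _ 0])

text \<open>\<open>S\<close> is constant on the coset of \<open>x\<close>, so \<open>\<parallel>S x\<parallel> \<le> \<parallel>S\<parallel> \<parallel>a\<parallel>\<close> holds for every representative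
  \<open>a\<close>, hence with the infimum of the \<open>\<parallel>a\<parallel>\<close>.\<close>

lemma norm_le_quot_norm:
  assumes Y: "subspace Y" and S: "\<And>y. y \<in> Y \<Longrightarrow> blinfun_apply S y = 0"
  shows "norm (blinfun_apply S x) \<le> norm S * quot_norm (quot_map Y x)"
proof (cases "norm S = 0")
  case False
  have "norm (blinfun_apply S x) / norm S \<le> quot_norm (quot_map Y x)"
    unfolding quot_norm_def
  proof (rule cINF_greatest)
    fix a
    assume "a \<in> quot_map Y x"
    then have "blinfun_apply S a = blinfun_apply S x"
      using S by (auto simp: quot_map_def blinfun.add_right)
    then show "norm (blinfun_apply S x) / norm S \<le> norm a"
      using norm_blinfun[of S a] False by (simp add: field_simps)
  qed (use in_quot_map[OF Y] in blast)
  then show ?thesis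
    using False by (simp add: field_simps)
qed simp

lemma quot_factor_in_quot_ops:
  assumes Y: "subspace Y" and S: "\<And>y. y \<in> Y \<Longrightarrow> blinfun_apply S y = 0"
  shows "quot_factor Y S \<in> quot_ops Y"
proof -
  note * = quot_factor_quot_map[OF Y S]
  have "quot_factor Y S (quot_add (quot_map Y x) (quot_map Y x'))
      = quot_factor Y S (quot_map Y x) + quot_factor Y S (quot_map Y x')" for x x'
    by (simp add: quot_map_add[OF Y, symmetric] * blinfun.add_right)
  moreover have "quot_factor Y S (quot_scale Y c (quot_map Y x))
      = c *\<^sub>R quot_factor Y S (quot_map Y x)" for c x
    by (simp add: quot_map_scaleR[OF Y, symmetric] * blinfun.scaleR_right)
  moreover have "\<exists>K. \<forall>x. norm (quot_factor Y S (quot_map Y x)) \<le> K * quot_norm (quot_map Y x)"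
    using norm_le_quot_norm[OF Y S] by (auto simp: *)
  ultimately show ?thesis
    unfolding quot_ops_def quot_space_def by (auto simp: quot_factor_def quot_space_def)
qed

lemma quot_pullback_apply:
  assumes Y: "subspace Y" and T: "T \<in> quot_ops Y"
  shows "blinfun_apply (quot_pullback Y T) x = T (quot_map Y x)"
proof -
  obtain K where K: "\<And>x. norm (T (quot_map Y x)) \<le> K * quot_norm (quot_map Y x)"
    using T by (auto simp: quot_ops_def quot_space_def)
  have "bounded_linear (\<lambda>x. T (quot_map Y x))"
  proof (rule bounded_linear_intro)
    show "T (quot_map Y (x + x')) = T (quot_map Y x) + T (quot_map Y x')" for x x'
      using T by (simp add: quot_map_add[OF Y] quot_ops_def)
    show "T (quot_map Y (c *\<^sub>R x)) = c *\<^sub>R T (quot_map Y x)" for c x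
      using T by (simp add: quot_map_scaleR[OF Y] quot_ops_def)
    fix x
    have "norm (T (quot_map Y x)) \<le> \<bar>K\<bar> * quot_norm (quot_map Y x)"
      using K[of x] quot_norm_nonneg[OF Y, of x] by (smt (verit) mult_right_mono)
    also have "\<dots> \<le> \<bar>K\<bar> * norm x"
      by (intro mult_left_mono quot_norm_le in_quot_map Y) simp
    finally show "norm (T (quot_map Y x)) \<le> norm x * \<bar>K\<bar>"
      by (simp add: mult.commute)
  qed
  then show ?thesis
    by (simp add: quot_pullback_def bounded_linear_Blinfun_apply)
qed

lemma quot_pullback_vanishes:
  assumes Y: "subspace Y" and "T \<in> quot_ops Y" "y \<in> Y"
  shows "blinfun_apply (quot_pullback Y T) y = 0"
proof -
  have "quot_map Y y = quot_map Y 0"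
    using assms(3) by (simp add: quot_map_eq_iff[OF Y])
  then have "blinfun_apply (quot_pullback Y T) y = blinfun_apply (quot_pullback Y T) 0"
    by (simp only: quot_pullback_apply[OF assms(1,2)])
  then show ?thesis by simp
qed

lemma quot_pullback_factor:
  assumes "subspace Y" "\<And>y. y \<in> Y \<Longrightarrow> blinfun_apply S y = 0"
  shows "quot_pullback Y (quot_factor Y S) = S"
  by (rule blinfun_eqI)
    (simp add: quot_pullback_apply quot_factor_in_quot_ops quot_factor_quot_map assms)

lemma quot_factor_pullback:
  assumes "subspace Y" "T \<in> quot_ops Y"
  shows "quot_factor Y (quot_pullback Y T) = T"
  by (rule quot_ops_eqI[of _ Y])
    (simp_all add: assms quot_factor_in_quot_ops quot_factor_quot_map quot_pullback_vanishes
      quot_pullback_apply)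

text \<open>The quotient map does not increase the norm, which gives one inequality; the other is the bound
  by the infimum over representatives. When \<open>Y\<close> is not closed, cosets of norm zero other than
  \<open>Y\<close> occur; operators vanish there, in accordance with the value \<open>0\<close> of a quotient by zero.\<close>

lemma quot_onorm_eq_norm_pullback:
  assumes Y: "subspace Y" and T: "T \<in> quot_ops Y"
  shows "quot_onorm Y T = norm (quot_pullback Y T)"
proof (rule antisym)
  let ?S = "quot_pullback Y T"
  have bound: "norm (T (quot_map Y x)) \<le> norm ?S * quot_norm (quot_map Y x)" for x
    using norm_le_quot_norm[OF Y, of ?S x] quot_pullback_vanishes[OF Y T]
    by (simp add: quot_pullback_apply[OF Y T])
  have quotient: "norm (T A) / quot_norm A \<le> norm ?S" if "A \<in> quot_space Y" for A
  proof -
    from that obtain x where A: "A = quot_map Y x" by (auto simp: quot_space_def)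
    show ?thesis
      using bound[of x] quot_norm_nonneg[OF Y, of x] unfolding A
      by (cases "quot_norm (quot_map Y x) = 0") (auto simp: divide_le_eq)
  qed
  then show "quot_onorm Y T \<le> norm ?S"
    unfolding quot_onorm_def by (intro cSUP_least) (auto simp: quot_space_def)
  have ge: "norm (T A) / quot_norm A \<le> quot_onorm Y T" if "A \<in> quot_space Y" for A
    unfolding quot_onorm_def using quotient that by (intro cSUP_upper) (auto intro!: bdd_aboveI2)
  show "norm ?S \<le> quot_onorm Y T"
  proof (rule norm_blinfun_bound)
    have "0 \<le> norm (T (quot_map Y 0)) / quot_norm (quot_map Y 0)"
      using quot_norm_nonneg[OF Y, of 0] by simp
    also have "\<dots> \<le> quot_onorm Y T"
      by (rule ge) simp
    finally show nonneg: "0 \<le> quot_onorm Y T" .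
    fix x
    have "norm (T (quot_map Y x)) \<le> quot_onorm Y T * quot_norm (quot_map Y x)"
      using ge[of "quot_map Y x"] quot_norm_nonneg[OF Y, of x] bound[of x]
      by (cases "quot_norm (quot_map Y x) = 0") (auto simp: divide_le_eq)
    also have "\<dots> \<le> quot_onorm Y T * norm x"
      by (intro mult_left_mono quot_norm_le in_quot_map Y nonneg)
    finally show "norm (blinfun_apply ?S x) \<le> quot_onorm Y T * norm x"
      by (simp add: quot_pullback_apply[OF Y T])
  qed
qed

lemma quot_factor_add: "quot_factor Y (S + T) = quot_op_add Y (quot_factor Y S) (quot_factor Y T)"
  by (auto simp: quot_factor_def quot_op_add_def blinfun.add_left)

lemma quot_factor_scaleR: "quot_factor Y (c *\<^sub>R S) = quot_op_scale Y c (quot_factor Y S)"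
  by (auto simp: quot_factor_def quot_op_scale_def blinfun.scaleR_left)


section \<open>Quotients of the free space\<close>

lemma linearization_add: "linearization (f + g) = linearization f + linearization g"
  by (rule linearization_eqI) (simp add: blinfun.add_left)

lemma linearization_scaleR: "linearization (c *\<^sub>R f) = c *\<^sub>R linearization f"
  by (rule linearization_eqI) (simp add: blinfun.scaleR_left)

lemma linearization_real: "linearization f = dual_of_lip f"
  by (rule linearization_eqI) simp

text \<open>Every operator on the free space is the linearization of its restriction to the points
  \<open>\<delta>\<^sub>x\<close>; this is where the surjectivity in the universal properties comes from.\<close>

lemma ex_linearization_eq:
  fixes T :: "'m::pointed_metric_space free_space \<Rightarrow>\<^sub>L 'e::banach"
  obtains f where "linearization f = T"
proof -
  have "norm (blinfun_apply T (delta x) - blinfun_apply T (delta y)) \<le> norm T * dist x y" for x y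
  proof -
    have "norm (blinfun_apply T (delta x - delta y)) \<le> norm T * norm (delta x - delta y)"
      by (rule norm_blinfun)
    also have "\<dots> \<le> norm T * dist x y"
      by (intro mult_left_mono norm_delta_diff_le) simp
    finally show ?thesis by (simp add: blinfun.diff_right)
  qed
  then have "lip0_apply (Lip0 (\<lambda>x. blinfun_apply T (delta x))) = (\<lambda>x. blinfun_apply T (delta x))"
    by (intro Lip0_apply) (auto simp: delta_base)
  then show thesis
    by (intro that[of "Lip0 (\<lambda>x. blinfun_apply T (delta x))"] linearization_eqI) simp
qed

text \<open>For a general target space, this is the analogue of the annihilator of \<open>Y\<close>. All statements
  about the quotient of the free space hold for every subspace \<open>Y\<close> with this set in the place of
  the equivariant maps.\<close>

definition lip_vanishing ::
    "'m::pointed_metric_space free_space set \<Rightarrow> ('m, 'e::banach) lip0 set" where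
  "lip_vanishing Y = {f. \<forall>\<mu>\<in>Y. blinfun_apply (linearization f) \<mu> = 0}"

lemma lip_annihilator_eq: "lip_annihilator Y = lip_vanishing Y"
  by (simp add: lip_annihilator_def lip_vanishing_def linearization_real)

lemma quot_factor_linearization:
  assumes "subspace Y" "f \<in> lip_vanishing Y"
  shows "quot_factor Y (linearization f) \<in> quot_ops Y"
    and "quot_factor Y (linearization f) (quot_map Y \<mu>) = blinfun_apply (linearization f) \<mu>"
  using assms by (auto simp: lip_vanishing_def quot_factor_in_quot_ops quot_factor_quot_map)

text \<open>Uniqueness: the values at the cosets of the \<open>\<delta>\<^sub>x\<close> determine the pullback of \<open>T\<close> to the free
  space, and the pullback determines \<open>T\<close>.\<close>

lemma quot_op_eq_quot_factor:
  assumes Y: "subspace Y" and T: "T \<in> quot_ops Y" "\<And>x. T (quot_map Y (delta x)) = lip0_apply f x"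
  shows "T = quot_factor Y (linearization f)"
proof -
  have "linearization f = quot_pullback Y T"
    by (rule linearization_eqI) (simp add: quot_pullback_apply[OF Y T(1)] T(2))
  then show ?thesis
    using quot_factor_pullback[OF Y T(1)] by simp
qed

lemma quot_lift_eq:
  assumes "subspace Y" "f \<in> lip_vanishing Y"
  shows "quot_lift Y f = quot_factor Y (linearization f)"
  unfolding quot_lift_def
  by (rule the_equality) (auto simp: quot_factor_linearization assms intro: quot_op_eq_quot_factor)

lemma norm_quot_lift:
  assumes "subspace Y" "f \<in> lip_vanishing Y"
  shows "quot_onorm Y (quot_lift Y f) = norm f"
  using assms
  by (simp add: quot_lift_eq quot_onorm_eq_norm_pullback quot_factor_linearization
      quot_pullback_factor lip_vanishing_def norm_linearization)

lemma bij_quot_lift: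
  fixes Y :: "'m::pointed_metric_space free_space set"
  assumes Y: "subspace Y"
  shows "bij_betw (quot_lift Y) (lip_vanishing Y :: ('m, 'e::banach) lip0 set) (quot_ops Y)"
  unfolding bij_betw_def
proof
  show "inj_on (quot_lift Y) (lip_vanishing Y :: ('m, 'e) lip0 set)"
  proof (rule inj_onI, rule lip0_eqI)
    fix f g :: "('m, 'e) lip0" and x
    assume "f \<in> lip_vanishing Y" "g \<in> lip_vanishing Y" "quot_lift Y f = quot_lift Y g"
    then have "blinfun_apply (linearization f) (delta x) = blinfun_apply (linearization g) (delta x)"
      by (metis Y quot_factor_linearization(2) quot_lift_eq)
    then show "lip0_apply f x = lip0_apply g x" by simp
  qed
  show "quot_lift Y ` lip_vanishing Y = (quot_ops Y :: ('m free_space set \<Rightarrow> 'e) set)"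
  proof (intro equalityI subsetI)
    fix T :: "'m free_space set \<Rightarrow> 'e"
    assume T: "T \<in> quot_ops Y"
    obtain f where f: "linearization f = quot_pullback Y T"
      by (rule ex_linearization_eq)
    then have "f \<in> lip_vanishing Y"
      by (simp add: lip_vanishing_def quot_pullback_vanishes[OF Y T])
    moreover from this have "quot_lift Y f = T"
      by (simp add: quot_lift_eq[OF Y] f quot_factor_pullback[OF Y T])
    ultimately show "T \<in> quot_lift Y ` lip_vanishing Y" by blast
  qed (auto simp: quot_lift_eq[OF Y] quot_factor_linearization[OF Y])
qed

lemma ex1_quot_lift:
  assumes "subspace Y" "f \<in> lip_vanishing Y"
  shows "\<exists>!T. T \<in> quot_ops Y \<and> (\<forall>x. T (quot_map Y (delta x)) = lip0_apply f x)"
  by (rule ex1I[of _ "quot_factor Y (linearization f)"])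
    (auto simp: quot_factor_linearization assms intro: quot_op_eq_quot_factor)

lemma quot_lift_add:
  assumes "subspace Y" "f \<in> lip_vanishing Y" "g \<in> lip_vanishing Y"
  shows "quot_lift Y (f + g) = quot_op_add Y (quot_lift Y f) (quot_lift Y g)"
proof -
  have "f + g \<in> lip_vanishing Y"
    using assms by (simp add: lip_vanishing_def linearization_add blinfun.add_left)
  then show ?thesis
    using assms by (simp add: quot_lift_eq linearization_add quot_factor_add)
qed

lemma quot_lift_scaleR:
  assumes "subspace Y" "f \<in> lip_vanishing Y"
  shows "quot_lift Y (c *\<^sub>R f) = quot_op_scale Y c (quot_lift Y f)"
proof -
  have "c *\<^sub>R f \<in> lip_vanishing Y"
    using assms by (simp add: lip_vanishing_def linearization_scaleR blinfun.scaleR_left)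
  then show ?thesis
    using assms by (simp add: quot_lift_eq linearization_scaleR quot_factor_scaleR)
qed

lemma inv_into_quot_lift_apply:
  fixes T :: "'m::pointed_metric_space free_space set \<Rightarrow> 'e::banach"
  assumes Y: "subspace Y" and T: "T \<in> quot_ops Y"
  shows "lip0_apply (inv_into (lip_vanishing Y) (quot_lift Y) T) x = T (quot_map Y (delta x))"
proof -
  let ?f = "inv_into (lip_vanishing Y) (quot_lift Y) T"
  have "T \<in> quot_lift Y ` lip_vanishing Y"
    using T unfolding bij_betw_imp_surj_on[OF bij_quot_lift[OF Y]] .
  then have f: "?f \<in> lip_vanishing Y" "quot_lift Y ?f = T"
    by (rule inv_into_into, rule f_inv_into_f)
  from f(2) have "T (quot_map Y (delta x)) = quot_factor Y (linearization ?f) (quot_map Y (delta x))"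
    by (simp add: quot_lift_eq[OF Y f(1)])
  then show ?thesis
    by (simp add: quot_factor_linearization[OF Y f(1)])
qed

lemma dual_of_lip_of_dual: "dual_of_lip (lip_of_dual \<phi>) = \<phi>"
  unfolding lip_of_dual_def by (rule surj_f_inv_f[OF bij_is_surj[OF bij_dual_of_lip]])

lemma dual_of_quot_map_adjoint: "dual_of_lip (quot_map_adjoint Y \<phi>) = quot_pullback Y \<phi>"
  by (simp add: quot_map_adjoint_def quot_pullback_def dual_of_lip_of_dual)

lemma quot_map_adjoint_apply:
  assumes "subspace Y" "\<phi> \<in> quot_ops Y"
  shows "lip0_apply (quot_map_adjoint Y \<phi>) x = \<phi> (quot_map Y (delta x))"
  using dual_of_lip_delta[of "quot_map_adjoint Y \<phi>" x]
  by (simp add: dual_of_quot_map_adjoint quot_pullback_apply assms)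

lemma norm_quot_map_adjoint:
  assumes "subspace Y" "\<phi> \<in> quot_ops Y"
  shows "norm (quot_map_adjoint Y \<phi>) = quot_onorm Y \<phi>"
  by (simp add: quot_onorm_eq_norm_pullback assms flip: norm_dual_of_lip dual_of_quot_map_adjoint)

lemma quot_map_adjoint_quot_lift:
  assumes "subspace Y" "f \<in> lip_vanishing Y"
  shows "quot_map_adjoint Y (quot_lift Y f) = f"
  by (rule lip0_eqI)
    (simp add: assms quot_map_adjoint_apply quot_lift_eq quot_factor_linearization)

text \<open>For real functions the adjoint of the quotient map is the inverse of the lift.\<close>

lemma range_quot_map_adjoint:
  assumes Y: "subspace Y"
  shows "quot_map_adjoint Y ` quot_ops Y = lip_vanishing Y"
  unfolding bij_betw_imp_surj_on[OF bij_quot_lift[OF Y], symmetric]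
  by (simp add: image_image quot_map_adjoint_quot_lift[OF Y])

lemma quot_op_add_in_quot_ops:
  assumes "subspace Y" "\<phi> \<in> quot_ops Y" "\<psi> \<in> quot_ops Y"
  shows "quot_op_add Y \<phi> \<psi> \<in> quot_ops Y"
proof -
  have "quot_op_add Y \<phi> \<psi> = quot_factor Y (quot_pullback Y \<phi> + quot_pullback Y \<psi>)"
    by (simp add: quot_factor_add quot_factor_pullback assms)
  then show ?thesis
    by (simp add: quot_factor_in_quot_ops blinfun.add_left quot_pullback_vanishes assms)
qed

lemma quot_op_scale_in_quot_ops:
  assumes "subspace Y" "\<phi> \<in> quot_ops Y"
  shows "quot_op_scale Y c \<phi> \<in> quot_ops Y"
proof -
  have "quot_op_scale Y c \<phi> = quot_factor Y (c *\<^sub>R quot_pullback Y \<phi>)"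
    by (simp add: quot_factor_scaleR quot_factor_pullback assms)
  then show ?thesis
    by (simp add: quot_factor_in_quot_ops blinfun.scaleR_left quot_pullback_vanishes assms)
qed

lemma quot_map_adjoint_add:
  assumes "subspace Y" "\<phi> \<in> quot_ops Y" "\<psi> \<in> quot_ops Y"
  shows "quot_map_adjoint Y (quot_op_add Y \<phi> \<psi>) = quot_map_adjoint Y \<phi> + quot_map_adjoint Y \<psi>"
  by (rule lip0_eqI)
    (simp add: quot_map_adjoint_apply assms quot_op_add_in_quot_ops, simp add: quot_op_add_def)

lemma quot_map_adjoint_scaleR:
  assumes "subspace Y" "\<phi> \<in> quot_ops Y"
  shows "quot_map_adjoint Y (quot_op_scale Y c \<phi>) = c *\<^sub>R quot_map_adjoint Y \<phi>"
  by (rule lip0_eqI)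
    (simp add: quot_map_adjoint_apply assms quot_op_scale_in_quot_ops, simp add: quot_op_scale_def)


section \<open>Actions by similarities\<close>

text \<open>The assumption of two distinct points makes the factor \<open>\<chi>(g)\<close> determined by \<open>g\<close>, so that
  \<open>\<chi>\<close> is a homomorphism; on a one-point space it could be arbitrary.\<close>

locale similarity = group_action G UNIV act
  for G :: "('g, 'z) monoid_scheme" (structure) and act :: "'g \<Rightarrow> 'm::pointed_metric_space \<Rightarrow> 'm" +
  fixes chi :: "'g \<Rightarrow> real"
  assumes act_base: "g \<in> carrier G \<Longrightarrow> act g 0 = 0"
    and chi_pos: "g \<in> carrier G \<Longrightarrow> 0 < chi g"
    and dist_act: "g \<in> carrier G \<Longrightarrow> dist (act g x) (act g y) = chi g * dist x y"
    and nontrivial: "\<exists>x y :: 'm. x \<noteq> y"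

sublocale similarity \<subseteq> group G
  by (rule group_hom.axioms(1)[OF group_hom])

context similarity
begin

lemma act_one [simp]: "act \<one> x = x"
  by (simp only: id_eq_one[symmetric] restrict_apply' UNIV_I)

lemma act_mult: "g \<in> carrier G \<Longrightarrow> h \<in> carrier G \<Longrightarrow> act (g \<otimes> h) x = act g (act h x)"
  by (rule composition_rule) auto

lemma act_inv:
  assumes "g \<in> carrier G"
  shows "act g (act (inv g) x) = x" "act (inv g) (act g x) = x"
  using assms by (simp_all flip: act_mult)

lemma chi_mult:
  assumes "g \<in> carrier G" "h \<in> carrier G"
  shows "chi (g \<otimes> h) = chi g * chi h"
proof -
  obtain x y :: 'm where "x \<noteq> y" using nontrivial by blast
  moreover have "chi (g \<otimes> h) * dist x y = chi g * chi h * dist x y"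
    using assms dist_act[of "g \<otimes> h" x y] by (auto simp: act_mult dist_act mult.assoc)
  ultimately show ?thesis by simp
qed

lemma chi_one [simp]: "chi \<one> = 1"
  using chi_mult[of \<one> \<one>] chi_pos[of \<one>] by simp

lemma chi_inv: "g \<in> carrier G \<Longrightarrow> chi (inv g) = inverse (chi g)"
  using chi_mult[of g "inv g"] by (simp add: inverse_unique)

lemma lip0_apply_U:
  assumes g: "g \<in> carrier G"
  shows "lip0_apply (lip_U G act chi g f) x = chi g * lip0_apply f (act (inv g) x)"
    and norm_U_le: "norm (lip_U G act chi g f) \<le> norm f"
proof -
  let ?f = "\<lambda>x. chi g * lip0_apply f (act (inv g) x)"
  have lip: "norm (?f x - ?f y) \<le> norm f * dist x y" for x y
  proof -
    have "norm (?f x - ?f y)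
        = chi g * norm (lip0_apply f (act (inv g) x) - lip0_apply f (act (inv g) y))"
      using chi_pos[OF g] by (simp add: abs_mult flip: right_diff_distrib)
    also have "\<dots> \<le> chi g * (norm f * dist (act (inv g) x) (act (inv g) y))"
      using chi_pos[OF g] by (intro mult_left_mono lip0_norm_diff_le) simp
    also have "\<dots> = norm f * dist x y"
      using g chi_pos[OF g] by (simp add: dist_act chi_inv)
    finally show ?thesis .
  qed
  have "lip0_apply (lip_U G act chi g f) = ?f"
    unfolding lip_U_def by (rule Lip0_apply) (use lip act_base g in auto)
  then show "lip0_apply (lip_U G act chi g f) x = ?f x"
    and "norm (lip_U G act chi g f) \<le> norm f"
    using lip by (auto intro: lip0_norm_le)
qed

lemma U_mult:
  assumes "g \<in> carrier G" "h \<in> carrier G"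
  shows "lip_U G act chi g \<circ> lip_U G act chi h = lip_U G act chi (g \<otimes> h)"
  by (rule ext, rule lip0_eqI)
    (simp add: assms lip0_apply_U chi_mult inv_mult_group act_mult)

lemma U_one: "lip_U G act chi \<one> = id"
  by (rule ext, rule lip0_eqI) (simp add: lip0_apply_U)

end

text \<open>Two mutually inverse contractions are isometries.\<close>

lemma surj_linear_isometryI:
  assumes "linear T" "\<And>x. norm (T x) \<le> norm x" "\<And>x. norm (S x) \<le> norm x"
    and "T \<circ> S = id" "S \<circ> T = id"
  shows "surj_linear_isometry T"
  unfolding surj_linear_isometry_def
proof (intro conjI allI)
  fix x
  have "norm x = norm (S (T x))"
    using assms(5) by (simp add: pointfree_idE)
  also have "\<dots> \<le> norm (T x)" by (rule assms(3))
  finally show "norm (T x) = norm x"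
    using assms(2)[of x] by simp
next
  show "surj T"
    using assms(4) by (metis pointfree_idE surjI)
qed (rule assms(1))

context similarity
begin

lemma surj_linear_isometry_U:
  assumes g: "g \<in> carrier G"
  shows "surj_linear_isometry (lip_U G act chi g)"
proof (rule surj_linear_isometryI)
  show "linear (lip_U G act chi g)"
    by (intro linearI lip0_eqI) (simp_all add: g lip0_apply_U distrib_left)
  show "lip_U G act chi g \<circ> lip_U G act chi (inv g) = id"
    and "lip_U G act chi (inv g) \<circ> lip_U G act chi g = id"
    using g by (simp_all add: U_mult U_one)
qed (use g in \<open>auto intro: norm_U_le\<close>)

lemma fixed_by_U: "{f. \<forall>g\<in>carrier G. lip_U G act chi g f = f} = lip0_equivariant G act chi"
proof (intro equalityI subsetI)
  fix f
  assume f: "f \<in> {f. \<forall>g\<in>carrier G. lip_U G act chi g f = f}"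
  have "lip0_apply f (act g x) = chi g * lip0_apply f x" if g: "g \<in> carrier G" for g x
  proof -
    have "lip0_apply f (act g x) = lip0_apply (lip_U G act chi g f) (act g x)"
      using f g by simp
    then show ?thesis
      using g by (simp add: lip0_apply_U act_inv)
  qed
  then show "f \<in> lip0_equivariant G act chi"
    by (simp add: lip0_equivariant_def)
next
  fix f :: "('m, real) lip0"
  assume f: "f \<in> lip0_equivariant G act chi"
  have "lip_U G act chi g f = f" if g: "g \<in> carrier G" for g
  proof (rule lip0_eqI)
    fix x
    have "lip0_apply f x = lip0_apply f (act g (act (inv g) x))"
      using g by (simp add: act_inv)
    also have "\<dots> = chi g * lip0_apply f (act (inv g) x)"
      using f g by (simp add: lip0_equivariant_def)
    finally show "lip0_apply (lip_U G act chi g f) x = lip0_apply f x"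
      using g by (simp add: lip0_apply_U)
  qed
  then show "f \<in> {f. \<forall>g\<in>carrier G. lip_U G act chi g f = f}" by simp
qed

text \<open>The map \<open>x \<mapsto> \<chi>(g)\<^sup>-\<^sup>1 \<delta>\<^sub>g\<^sub>x\<close> is nonexpansive, because \<open>x \<mapsto> gx\<close> multiplies distances
  by \<open>\<chi>(g)\<close>.\<close>

definition V :: "'g \<Rightarrow> 'm free_space \<Rightarrow>\<^sub>L 'm free_space" where
  "V g = linearization (Lip0 (\<lambda>x. inverse (chi g) *\<^sub>R delta (act g x)))"

lemma V_delta:
  assumes g: "g \<in> carrier G"
  shows "blinfun_apply (V g) (delta x) = inverse (chi g) *\<^sub>R delta (act g x)"
    and norm_V_le: "norm (V g) \<le> 1"
proof -
  let ?f = "\<lambda>x. inverse (chi g) *\<^sub>R delta (act g x)"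
  have lip: "norm (?f x - ?f y) \<le> 1 * dist x y" for x y
  proof -
    have "norm (?f x - ?f y) = inverse (chi g) * norm (delta (act g x) - delta (act g y))"
      using chi_pos[OF g] by (simp flip: scaleR_diff_right)
    also have "\<dots> \<le> inverse (chi g) * dist (act g x) (act g y)"
      using chi_pos[OF g] by (intro mult_left_mono norm_delta_diff_le) simp
    also have "\<dots> = 1 * dist x y"
      using g chi_pos[OF g] by (simp add: dist_act)
    finally show ?thesis .
  qed
  have f: "lip0_apply (Lip0 ?f) = ?f"
    by (rule Lip0_apply[OF _ lip]) (simp_all add: act_base g delta_base)
  then show "blinfun_apply (V g) (delta x) = ?f x"
    by (simp add: V_def)
  show "norm (V g) \<le> 1"
    unfolding V_def norm_linearization using lip f by (intro lip0_norm_le) auto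
qed

lemma V_mult:
  assumes "g \<in> carrier G" "h \<in> carrier G"
  shows "blinfun_apply (V g) \<circ> blinfun_apply (V h) = blinfun_apply (V (g \<otimes> h))"
proof -
  have "V g o\<^sub>L V h = V (g \<otimes> h)"
    by (rule free_blinfun_eqI)
      (simp add: assms V_delta act_mult chi_mult blinfun.scaleR_right mult.commute)
  then show ?thesis by (metis blinfun_compose.rep_eq)
qed

lemma V_one: "blinfun_apply (V \<one>) = id"
proof -
  have "V \<one> = id_blinfun"
    by (rule free_blinfun_eqI) (simp add: V_delta)
  then show ?thesis by (simp add: id_def)
qed

lemma is_free_V_V:
  assumes g: "g \<in> carrier G"
  shows "is_free_V act chi g (blinfun_apply (V g))"
  unfolding is_free_V_def
proof (intro conjI allI V_delta g)
  have le: "norm (blinfun_apply (V h) x) \<le> norm x" if "h \<in> carrier G" for h x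
  proof -
    have "norm (blinfun_apply (V h) x) \<le> norm (V h) * norm x" by (rule norm_blinfun)
    also have "\<dots> \<le> 1 * norm x"
      by (intro mult_right_mono norm_V_le that) simp
    finally show ?thesis by simp
  qed
  show "surj_linear_isometry (blinfun_apply (V g))"
  proof (rule surj_linear_isometryI)
    show "blinfun_apply (V g) \<circ> blinfun_apply (V (inv g)) = id"
      and "blinfun_apply (V (inv g)) \<circ> blinfun_apply (V g) = id"
      using g by (simp_all add: V_mult V_one)
  qed (use g le in \<open>auto intro: bounded_linear.linear blinfun.bounded_linear_right\<close>)
qed

lemma is_free_V_unique:
  assumes g: "g \<in> carrier G" and W: "is_free_V act chi g W"
  shows "W = blinfun_apply (V g)"
proof -
  have "bounded_linear W"
    using W by (auto simp: is_free_V_def surj_linear_isometry_def linear_add linear_scale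
        intro!: bounded_linear_intro[of _ 1])
  then have W': "blinfun_apply (Blinfun W) = W"
    by (rule bounded_linear_Blinfun_apply)
  have "Blinfun W = V g"
    using W by (intro free_blinfun_eqI) (simp add: W' is_free_V_def V_delta g)
  with W' show ?thesis by simp
qed

lemma ex1_free_V: "g \<in> carrier G \<Longrightarrow> \<exists>!W. is_free_V act chi g W"
  using is_free_V_V is_free_V_unique by blast

lemma free_V_eq: "g \<in> carrier G \<Longrightarrow> free_V act chi g = blinfun_apply (V g)"
  unfolding free_V_def by (intro the_equality is_free_V_V is_free_V_unique)

lemma dual_of_U:
  assumes g: "g \<in> carrier G"
  shows "dual_of_lip (lip_U G act chi g f)
    = dual_adjoint (blinfun_apply (V (inv g))) (dual_of_lip f)"
proof -
  have "dual_of_lip (lip_U G act chi g f) = dual_of_lip f o\<^sub>L V (inv g)"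
    using g by (intro free_blinfun_eqI)
      (simp add: lip0_apply_U V_delta chi_inv blinfun.scaleR_right)
  also have "\<dots> = dual_adjoint (blinfun_apply (V (inv g))) (dual_of_lip f)"
    unfolding dual_adjoint_def blinfun_apply_blinfun_compose[symmetric] blinfun_apply_inverse ..
  finally show ?thesis .
qed

lemma subspace_Y: "subspace (similarity_Y G act chi)"
  unfolding similarity_Y_def by (intro subspace_closure subspace_span)

text \<open>On a generator \<open>\<delta>\<^sub>g\<^sub>x - \<chi>(g) \<delta>\<^sub>x\<close> the linearization of \<open>f\<close> takes the value
  \<open>f(gx) - \<chi>(g) f(x)\<close>, and its kernel is a closed subspace.\<close>

lemma lip_vanishing_Y:
  "lip_vanishing (similarity_Y G act chi) = (lip0_equivariant G act chi :: ('m, 'e::banach) lip0 set)"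
proof (intro equalityI subsetI)
  fix f :: "('m, 'e) lip0"
  assume f: "f \<in> lip_vanishing (similarity_Y G act chi)"
  have "lip0_apply f (act g x) = chi g *\<^sub>R lip0_apply f x" if "g \<in> carrier G" for g x
  proof -
    have "delta (act g x) - chi g *\<^sub>R delta x \<in> similarity_Y G act chi"
      unfolding similarity_Y_def using that
      by (intro subsetD[OF closure_subset] span_base) blast
    with f have "blinfun_apply (linearization f) (delta (act g x) - chi g *\<^sub>R delta x) = 0"
      by (simp add: lip_vanishing_def)
    then show ?thesis by (simp add: blinfun.diff_right blinfun.scaleR_right)
  qed
  then show "f \<in> lip0_equivariant G act chi"
    by (simp add: lip0_equivariant_def)
next
  fix f :: "('m, 'e) lip0"
  assume f: "f \<in> lip0_equivariant G act chi"
  let ?K = "{\<mu>. blinfun_apply (linearization f) \<mu> = 0}"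
  have "similarity_Y G act chi \<subseteq> ?K"
    unfolding similarity_Y_def
  proof (intro closure_minimal span_minimal)
    show "{delta (act g x) - chi g *\<^sub>R delta x |g x. g \<in> carrier G} \<subseteq> ?K"
      using f by (auto simp: lip0_equivariant_def blinfun.diff_right blinfun.scaleR_right)
    show "subspace ?K"
      by (intro subspaceI) (auto simp: blinfun.add_right blinfun.scaleR_right)
    show "closed ?K"
      by (intro closed_Collect_eq linear_continuous_on blinfun.bounded_linear_right
          continuous_on_const)
  qed
  then show "f \<in> lip_vanishing (similarity_Y G act chi)"
    by (auto simp: lip_vanishing_def)
qed

text \<open>On the points the generators agree up to a factor: \<open>\<delta>\<^sub>g\<^sub>x - \<chi>(g) \<delta>\<^sub>x = \<chi>(g) (V\<^sub>g \<delta>\<^sub>x - \<delta>\<^sub>x)\<close>. For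
  general \<open>\<mu>\<close>, the set where \<open>V\<^sub>g \<mu> - \<mu>\<close> lies in \<open>Y\<close> is a closed subspace containing all
  \<open>\<delta>\<^sub>x\<close>, hence everything.\<close>

lemma similarity_Y_eq_orbit_differences:
  "similarity_Y G act chi
    = closure (span {blinfun_apply (V g) \<mu> - \<mu> | g \<mu>. g \<in> carrier G})" (is "?Y = closure (span ?D)")
proof
  have gen: "delta (act g x) - chi g *\<^sub>R delta x
      = chi g *\<^sub>R (blinfun_apply (V g) (delta x) - delta x)" if "g \<in> carrier G" for g x
    using chi_pos[OF that] by (simp add: V_delta that scaleR_diff_right)
  show "?Y \<subseteq> closure (span ?D)"
    unfolding similarity_Y_def
  proof (intro closure_mono span_minimal subspace_span subsetI)
    fix \<nu>
    assume "\<nu> \<in> {delta (act g x) - chi g *\<^sub>R delta x |g x. g \<in> carrier G}"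
    then obtain g x where g: "g \<in> carrier G" "\<nu> = delta (act g x) - chi g *\<^sub>R delta x" by blast
    have "blinfun_apply (V g) (delta x) - delta x \<in> ?D" using g(1) by blast
    then show "\<nu> \<in> span ?D"
      unfolding g(2) gen[OF g(1)] by (intro span_scale span_base)
  qed
  have "blinfun_apply (V g) \<mu> - \<mu> \<in> ?Y" if g: "g \<in> carrier G" for g \<mu>
  proof -
    let ?K = "(\<lambda>\<mu>. blinfun_apply (V g) \<mu> - \<mu>) -` ?Y"
    have lin: "bounded_linear (\<lambda>\<mu>. blinfun_apply (V g) \<mu> - \<mu>)"
      by (intro bounded_linear_sub blinfun.bounded_linear_right bounded_linear_ident)
    have "closure (span (range delta)) \<subseteq> ?K"
    proof (intro closure_minimal span_minimal)
      show "range delta \<subseteq> ?K"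
      proof clarsimp
        fix x
        have "blinfun_apply (V g) (delta x) - delta x
            = inverse (chi g) *\<^sub>R (delta (act g x) - chi g *\<^sub>R delta x)"
          using chi_pos[OF g] by (simp add: gen[OF g])
        moreover have "delta (act g x) - chi g *\<^sub>R delta x \<in> ?Y"
          unfolding similarity_Y_def using g by (intro subsetD[OF closure_subset] span_base) blast
        ultimately show "blinfun_apply (V g) (delta x) - delta x \<in> ?Y"
          using subspace_scale[OF subspace_Y] by simp
      qed
      show "subspace ?K"
        by (rule linear_subspace_vimage[OF bounded_linear.linear[OF lin] subspace_Y])
      show "closed ?K"
        by (rule closed_vimage) (auto simp: similarity_Y_def intro: linear_continuous_on lin)
    qed
    then show ?thesis unfolding span_delta_dense by blast
  qed
  then have "?D \<subseteq> ?Y" by blast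
  then show "closure (span ?D) \<subseteq> ?Y"
    by (intro closure_minimal span_minimal subspace_Y) (auto simp: similarity_Y_def)
qed

end

section \<open>Duality and the universal property of the quotient\<close>

theorem theorem1p1:
  fixes G :: "('g, 'z) monoid_scheme" (structure)
    and act :: "'g \<Rightarrow> 'm::pointed_metric_space \<Rightarrow> 'm"
    and chi :: "'g \<Rightarrow> real"
  assumes nontrivial: "\<exists>x y :: 'm. x \<noteq> y"
    and action: "similarity_action G act chi"
  shows
    "let U = lip_U G act chi; V = free_V act chi; Y = similarity_Y G act chi in
     ((\<forall>g\<in>carrier G.
         (\<forall>f x. lip0_apply (U g f) x = chi g * lip0_apply f (act (inv g) x)) \<and>
         surj_linear_isometry (U g) \<and>
         (\<exists>!W. is_free_V act chi g W) \<and>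
         is_free_V act chi g (V g)) \<and>
      U \<one> = id \<and> V \<one> = id \<and>
      (\<forall>g\<in>carrier G. \<forall>h\<in>carrier G. U g \<circ> U h = U (g \<otimes> h) \<and> V g \<circ> V h = V (g \<otimes> h)) \<and>
      (\<forall>g\<in>carrier G. \<forall>f. dual_of_lip (U g f) = dual_adjoint (V (inv g)) (dual_of_lip f)) \<and>
      {f. \<forall>g\<in>carrier G. U g f = f} = lip0_equivariant G act chi)
     \<and>
     (Y = closure (span {V g \<mu> - \<mu> | g \<mu>. g \<in> carrier G}) \<and>
      lip_annihilator Y = lip0_equivariant G act chi \<and>
      (\<forall>\<phi>\<in>quot_ops Y. \<forall>\<psi>\<in>quot_ops Y.
         quot_map_adjoint Y (quot_op_add Y \<phi> \<psi>) = quot_map_adjoint Y \<phi> + quot_map_adjoint Y \<psi>) \<and>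
      (\<forall>c. \<forall>\<phi>\<in>quot_ops Y.
         quot_map_adjoint Y (quot_op_scale Y c \<phi>) = c *\<^sub>R quot_map_adjoint Y \<phi>) \<and>
      (\<forall>\<phi>\<in>quot_ops Y. norm (quot_map_adjoint Y \<phi>) = quot_onorm Y \<phi>) \<and>
      quot_map_adjoint Y ` quot_ops Y = lip0_equivariant G act chi \<and>
      (\<forall>\<phi>\<in>quot_ops Y. \<forall>x. lip0_apply (quot_map_adjoint Y \<phi>) x = \<phi> (quot_map Y (delta x))))
     \<and>
     (let L = (lip0_equivariant G act chi :: ('m, 'e::banach) lip0 set); \<Lambda> = quot_lift Y in
      (\<forall>f\<in>L.
         (\<exists>!T. T \<in> quot_ops Y \<and> (\<forall>x. T (quot_map Y (delta x)) = lip0_apply f x)) \<and>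
         (\<forall>\<mu>. blinfun_apply (linearization f) \<mu> = \<Lambda> f (quot_map Y \<mu>)) \<and>
         quot_onorm Y (\<Lambda> f) = norm (linearization f) \<and>
         norm (linearization f) = lip_const (lip0_apply f)) \<and>
      (\<forall>f\<in>L. \<forall>g\<in>L. \<Lambda> (f + g) = quot_op_add Y (\<Lambda> f) (\<Lambda> g)) \<and>
      (\<forall>c. \<forall>f\<in>L. \<Lambda> (c *\<^sub>R f) = quot_op_scale Y c (\<Lambda> f)) \<and>
      (\<forall>f\<in>L. quot_onorm Y (\<Lambda> f) = norm f) \<and>
      bij_betw \<Lambda> L (quot_ops Y) \<and>
      (\<forall>T\<in>quot_ops Y. \<forall>x. lip0_apply (inv_into L \<Lambda> T) x = T (quot_map Y (delta x))))"
proof -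
  interpret similarity G act chi
    using action nontrivial
    by (intro similarity.intro similarity_axioms.intro) (auto simp: similarity_action_def)
  let ?Y = "similarity_Y G act chi"
  note Y = subspace_Y
  note lift = lip_vanishing_Y[where 'e = 'e, symmetric]
  note quot_factor = quot_factor_linearization[OF Y]
  have orbit: "{free_V act chi g \<mu> - \<mu> | g \<mu>. g \<in> carrier G}
      = {blinfun_apply (V g) \<mu> - \<mu> | g \<mu>. g \<in> carrier G}"
    by (rule Collect_cong) (metis free_V_eq)
  show ?thesis
    unfolding Let_def
  proof (intro conjI ballI allI)
    show "similarity_Y G act chi
        = closure (span {free_V act chi g \<mu> - \<mu> | g \<mu>. g \<in> carrier G})"
      unfolding orbit by (rule similarity_Y_eq_orbit_differences)
    show "lip_annihilator ?Y = lip0_equivariant G act chi"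
      by (simp add: lip_annihilator_eq lip_vanishing_Y)
    show "quot_map_adjoint ?Y ` quot_ops ?Y = lip0_equivariant G act chi"
      by (simp add: range_quot_map_adjoint[OF Y] lip_vanishing_Y)
    show "bij_betw (quot_lift ?Y) (lip0_equivariant G act chi :: ('m, 'e) lip0 set) (quot_ops ?Y)"
      unfolding lift by (rule bij_quot_lift[OF Y])
  next
    fix f g :: "('m, 'e) lip0"
    assume fg: "f \<in> lip0_equivariant G act chi" "g \<in> lip0_equivariant G act chi"
    then show "quot_lift ?Y (f + g) = quot_op_add ?Y (quot_lift ?Y f) (quot_lift ?Y g)"
      unfolding lift by (rule quot_lift_add[OF Y])
  next
    fix f :: "('m, 'e) lip0"
    assume f: "f \<in> lip0_equivariant G act chi"
    then show "\<exists>!T. T \<in> quot_ops ?Y \<and> (\<forall>x. T (quot_map ?Y (delta x)) = lip0_apply f x)"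
      unfolding lift by (rule ex1_quot_lift[OF Y])
    show "quot_lift ?Y (c *\<^sub>R f) = quot_op_scale ?Y c (quot_lift ?Y f)" for c
      using f unfolding lift by (rule quot_lift_scaleR[OF Y])
    show "blinfun_apply (linearization f) \<mu> = quot_lift ?Y f (quot_map ?Y \<mu>)" for \<mu>
      using f unfolding lift by (simp add: quot_lift_eq[OF Y] quot_factor)
    show "quot_onorm ?Y (quot_lift ?Y f) = norm f"
      and "quot_onorm ?Y (quot_lift ?Y f) = norm (linearization f)"
      using f unfolding lift by (simp_all add: norm_quot_lift[OF Y] norm_linearization)
    show "norm (linearization f) = lip_const (lip0_apply f)"
      by (simp add: norm_linearization norm_lip0_eq)
  next
    fix T :: "'m free_space set \<Rightarrow> 'e" and x
    assume "T \<in> quot_ops ?Y"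
    then show "lip0_apply (inv_into (lip0_equivariant G act chi) (quot_lift ?Y) T) x
        = T (quot_map ?Y (delta x))"
      unfolding lift by (rule inv_into_quot_lift_apply[OF Y])
  qed (simp_all add: free_V_eq lip0_apply_U surj_linear_isometry_U ex1_free_V is_free_V_V U_one
      V_one U_mult V_mult dual_of_U fixed_by_U quot_map_adjoint_add[OF Y]
      quot_map_adjoint_scaleR[OF Y] norm_quot_map_adjoint[OF Y] quot_map_adjoint_apply[OF Y])
qed

end
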